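(* Let $X,Y$ be Banach spaces over $\mathbb{F}$ ($\mathbb{F}=\mathbb{R}$ or $\mathbb{C}$) and let $k\ge 1$ be an integer. Suppose that there is a uniformly strongly exposed set $\{x_\alpha\}$ of points of the unit sphere $S_X$ which is a norming subset of $\mathcal{P}({}^kX)$. Then the set of all elements of $\mathcal{P}({}^kX:Y)$ that strongly attain their norm is dense in $\mathcal{P}({}^kX:Y)$. In particular, the set of all points at which the norm of $\mathcal{P}({}^kX)$ is Fréchet differentiable is a dense $G_\delta$ subset of $\mathcal{P}({}^kX)$.
   Context: $B_X$ and $S_X$ are the closed unit ball and the unit sphere of $X$. A $k$-homogeneous polynomial $P:X\to Y$ is a map of the form $P(x)=L(x,\dots,x)$ for some bounded $k$-linear map $L:X\times\dots\times X\to Y$; $\mathcal{P}({}^kX:Y)$ is the Banach space of all such polynomials with norm $\|P\|=\sup_{x\in B_X}\|P(x)\|$, and $\mathcal{P}({}^kX)=\mathcal{P}({}^kX:\mathbb{F})$. A $k$-homogeneous polynomial $P:X\to Y$ strongly attains its norm at $z$ if every sequence $(x_n)$ in $B_X$ with $\lim_n\|P(x_n)\|=\|P\|$ has a subsequence converging in norm to $\lambda z$ for some scalar $\lambda\in\mathbb{F}$ with $|\lambda|=1$; $P$ strongly attains its norm if it does so at some $z$. A set $\{x_\alpha\}\subseteq S_X$ is uniformly strongly exposed (u.s.e.) if there are a function $\delta(\epsilon)$ with $\delta(\epsilon)>0$ for every $\epsilon>0$ and a set $\{f_\alpha\}$ of norm-one elements of $X^*$ such that for every $\alpha$, $f_\alpha(x_\alpha)=1$,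 and for every $\epsilon>0$ and every $x\in X$, $\|x\|\le 1$ and $\operatorname{Re}f_\alpha(x)\ge 1-\delta(\epsilon)$ imply $\|x-x_\alpha\|\le\epsilon$. The set $\{x_\alpha\}$ is a norming subset of $\mathcal{P}({}^kX)$ if $\|P\|=\sup_\alpha|P(x_\alpha)|$ for every $P\in\mathcal{P}({}^kX)$. The norm of a Banach space $E$ is Fréchet differentiable at $x\in E$ if $\lim_{\delta\to0}\sup_{\|y\|=1}\frac{\|x+\delta y\|+\|x-\delta y\|-2\|x\|}{\delta}=0$.
   Formalization: The space Y is assumed to be nonzero; for Y = {0} and X nonzero the only polynomial is 0, which does not strongly attain its norm, so the density claim fails as literally stated. For X = {0} the supremum over an empty norming set is left unspecified. *)

theory Defs
  imports "HOL-Analysis.Analysis"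
begin

text \<open>
  The scalar field is \<open>\<real>\<close> or \<open>\<complex>\<close>. The axioms admit nothing else, up to isometric isomorphism:
  if the imaginary unit \<open>rc_i\<close> is 0, then every scalar is real; if its square is \<open>-1\<close>, then
  the field is \<open>\<complex>\<close> with its usual absolute value.
\<close>

class rc_field = real_normed_field +
  fixes rc_Re :: "'a \<Rightarrow> real" and rc_Im :: "'a \<Rightarrow> real" and rc_i :: 'a
  assumes rc_decomp: "z = rc_Re z *\<^sub>R 1 + rc_Im z *\<^sub>R rc_i"
    and rc_i_cases: "rc_i = 0 \<or> rc_i * rc_i = - 1"
    and rc_norm: "(norm z)\<^sup>2 = (rc_Re z)\<^sup>2 + (rc_Im z)\<^sup>2"

instantiation real :: rc_field
begin
definition "rc_Re (x::real) = x"
definition "rc_Im (x::real) = (0::real)"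
definition "rc_i = (0::real)"
instance
  by standard (simp_all add: rc_Re_real_def rc_Im_real_def rc_i_real_def)
end

instantiation complex :: rc_field
begin
definition "rc_Re (z::complex) = Re z"
definition "rc_Im (z::complex) = Im z"
definition "rc_i = \<i>"
instance
  by standard
    (simp_all add: rc_Re_complex_def rc_Im_complex_def rc_i_complex_def complex_eq_iff cmod_power2)
end

text \<open>
  The type classes for normed and Banach spaces only carry real scalars; \<open>scale\<close> is the
  multiplication by scalars in \<open>'f\<close>, compatible with the real structure and the norm.
  For \<open>'f = real\<close> it can only be the real scalar multiplication.
\<close>

locale normed_space_over = vector_space scale
  for scale :: "'f::rc_field \<Rightarrow> 'a::real_normed_vector \<Rightarrow> 'a" +
  assumes scale_of_real: "scale (of_real r) x = r *\<^sub>R x"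
    and norm_scale: "norm (scale c x) = norm c * norm x"

lemma normed_space_over_self: "normed_space_over ((*) :: 'f::rc_field \<Rightarrow> 'f \<Rightarrow> 'f)"
  by unfold_locales (simp_all add: algebra_simps norm_mult scaleR_conv_of_real)

lemma normed_space_over_scaleR: "normed_space_over (scaleR :: real \<Rightarrow> 'a::real_normed_vector \<Rightarrow> 'a)"
  by unfold_locales (simp_all add: scaleR_add_left scaleR_add_right)

text \<open>
  A \<open>k\<close>-linear map is a function on lists of which only the values on lists of length \<open>k\<close> matter.
\<close>

definition bounded_multilinear ::
    "nat \<Rightarrow> ('f::rc_field \<Rightarrow> 'a::real_normed_vector \<Rightarrow> 'a) \<Rightarrow>
      ('f \<Rightarrow> 'b::real_normed_vector \<Rightarrow> 'b) \<Rightarrow> ('a list \<Rightarrow> 'b) \<Rightarrow> bool" where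
  "bounded_multilinear k sX sY L \<longleftrightarrow>
    (\<forall>xs i. length xs = k \<longrightarrow> i < k \<longrightarrow> Vector_Spaces.linear sX sY (\<lambda>v. L (xs[i := v]))) \<and>
    (\<exists>C. \<forall>xs. length xs = k \<longrightarrow> norm (L xs) \<le> C * prod_list (map norm xs))"

definition hpoly ::
    "nat \<Rightarrow> ('f::rc_field \<Rightarrow> 'a::real_normed_vector \<Rightarrow> 'a) \<Rightarrow>
      ('f \<Rightarrow> 'b::real_normed_vector \<Rightarrow> 'b) \<Rightarrow> ('a \<Rightarrow> 'b) set" where
  "hpoly k sX sY = {P. \<exists>L. bounded_multilinear k sX sY L \<and> P = (\<lambda>x. L (replicate k x))}"

definition pnorm :: "('a::real_normed_vector \<Rightarrow> 'b::real_normed_vector) \<Rightarrow> real" where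
  "pnorm P = (SUP x\<in>cball 0 1. norm (P x))"

text \<open>
  The value 0 off \<open>hpoly\<close> is irrelevant to the topology; it is there because \<open>Metric_space\<close>
  demands nonnegativity and symmetry off the carrier as well.
\<close>

definition hpoly_dist ::
    "nat \<Rightarrow> ('f::rc_field \<Rightarrow> 'a::real_normed_vector \<Rightarrow> 'a) \<Rightarrow>
      ('f \<Rightarrow> 'b::real_normed_vector \<Rightarrow> 'b) \<Rightarrow> ('a \<Rightarrow> 'b) \<Rightarrow> ('a \<Rightarrow> 'b) \<Rightarrow> real" where
  "hpoly_dist k sX sY P Q =
    (if P \<in> hpoly k sX sY \<and> Q \<in> hpoly k sX sY then pnorm (\<lambda>x. P x - Q x) else 0)"

definition hpoly_topology ::
    "nat \<Rightarrow> ('f::rc_field \<Rightarrow> 'a::real_normed_vector \<Rightarrow> 'a) \<Rightarrow>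
      ('f \<Rightarrow> 'b::real_normed_vector \<Rightarrow> 'b) \<Rightarrow> ('a \<Rightarrow> 'b) topology" where
  "hpoly_topology k sX sY = Metric_space.mtopology (hpoly k sX sY) (hpoly_dist k sX sY)"

definition strongly_attains_norm_at ::
    "('f::rc_field \<Rightarrow> 'a::real_normed_vector \<Rightarrow> 'a) \<Rightarrow>
      ('a \<Rightarrow> 'b::real_normed_vector) \<Rightarrow> 'a \<Rightarrow> bool" where
  "strongly_attains_norm_at sX P z \<longleftrightarrow>
    (\<forall>x :: nat \<Rightarrow> 'a. (\<forall>n. x n \<in> cball 0 1) \<and> (\<lambda>n. norm (P (x n))) \<longlonglongrightarrow> pnorm P \<longrightarrow>
      (\<exists>r c. strict_mono r \<and> norm c = 1 \<and> (x \<circ> r) \<longlonglongrightarrow> sX c z))"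

definition strongly_attains_norm ::
    "('f::rc_field \<Rightarrow> 'a::real_normed_vector \<Rightarrow> 'a) \<Rightarrow>
      ('a \<Rightarrow> 'b::real_normed_vector) \<Rightarrow> bool" where
  "strongly_attains_norm sX P \<longleftrightarrow> (\<exists>z. strongly_attains_norm_at sX P z)"

definition bounded_functional ::
    "('f::rc_field \<Rightarrow> 'a::real_normed_vector \<Rightarrow> 'a) \<Rightarrow> ('a \<Rightarrow> 'f) \<Rightarrow> bool" where
  "bounded_functional sX f \<longleftrightarrow> Vector_Spaces.linear sX (*) f \<and> bounded_linear f"

definition uniformly_strongly_exposed ::
    "('f::rc_field \<Rightarrow> 'a::real_normed_vector \<Rightarrow> 'a) \<Rightarrow> 'a set \<Rightarrow> bool" where
  "uniformly_strongly_exposed sX A \<longleftrightarrow> A \<subseteq> sphere 0 1 \<and>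
    (\<exists>(\<delta> :: real \<Rightarrow> real) (f :: 'a \<Rightarrow> 'a \<Rightarrow> 'f).
      (\<forall>\<epsilon>>0. \<delta> \<epsilon> > 0) \<and>
      (\<forall>a\<in>A. bounded_functional sX (f a) \<and> onorm (f a) = 1 \<and> f a a = 1 \<and>
        (\<forall>\<epsilon>>0. \<forall>x. norm x \<le> 1 \<and> rc_Re (f a x) \<ge> 1 - \<delta> \<epsilon> \<longrightarrow> norm (x - a) \<le> \<epsilon>)))"

text \<open>
  For \<open>A = {}\<close> the supremum is an unspecified real; as \<open>P = 0\<close> is among the polynomials, the
  condition then says that this real is 0 and that every polynomial has norm 0.
\<close>

definition norming_for_hpoly ::
    "nat \<Rightarrow> ('f::rc_field \<Rightarrow> 'a::real_normed_vector \<Rightarrow> 'a) \<Rightarrow> 'a set \<Rightarrow> bool" where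
  "norming_for_hpoly k sX A \<longleftrightarrow>
    (\<forall>P \<in> hpoly k sX ((*) :: 'f \<Rightarrow> 'f \<Rightarrow> 'f). pnorm P = (SUP a\<in>A. norm (P a)))"

definition norm_frechet_differentiable_at ::
    "('a::real_normed_vector \<Rightarrow> 'b::real_normed_vector) set \<Rightarrow> ('a \<Rightarrow> 'b) \<Rightarrow> bool" where
  "norm_frechet_differentiable_at E P \<longleftrightarrow>
    ((\<lambda>\<delta>::real. SUP Q\<in>{Q\<in>E. pnorm Q = 1}.
        (pnorm (\<lambda>x. P x + \<delta> *\<^sub>R Q x) + pnorm (\<lambda>x. P x - \<delta> *\<^sub>R Q x) - 2 * pnorm P) / \<delta>)
      \<longlongrightarrow> 0) (at 0)"


subsection \<open>The metric on the space of homogeneous polynomials\<close>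

lemma bdd_above_hpoly:
  assumes "P \<in> hpoly k sX sY"
  shows "bdd_above ((\<lambda>x. norm (P x)) ` cball 0 1)"
proof -
  obtain L C where P: "P = (\<lambda>x. L (replicate k x))"
    and C: "\<And>xs. length xs = k \<Longrightarrow> norm (L xs) \<le> C * prod_list (map norm xs)"
    using assms unfolding hpoly_def bounded_multilinear_def by blast
  have "norm (P x) \<le> \<bar>C\<bar>" if "x \<in> cball 0 1" for x
  proof -
    have "norm (P x) \<le> C * norm x ^ k"
      using C[of "replicate k x"] by (simp add: P prod_list_replicate)
    also have "\<dots> \<le> \<bar>C\<bar> * norm x ^ k"
      by (intro mult_right_mono) auto
    also have "\<dots> \<le> \<bar>C\<bar> * 1"
      using that by (intro mult_left_mono power_le_one) auto
    finally show ?thesis by simp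
  qed
  then show ?thesis
    by (auto intro!: bdd_aboveI2)
qed

lemma hpoly_diff:
  assumes "normed_space_over sX" "normed_space_over sY"
    and "P \<in> hpoly k sX sY" "Q \<in> hpoly k sX sY"
  shows "(\<lambda>x. P x - Q x) \<in> hpoly k sX sY"
proof -
  interpret X: normed_space_over sX by fact
  interpret Y: normed_space_over sY by fact
  interpret XY: vector_space_pair sX sY by unfold_locales
  obtain L C where P: "P = (\<lambda>x. L (replicate k x))"
    and L: "\<And>xs i. length xs = k \<Longrightarrow> i < k \<Longrightarrow> Vector_Spaces.linear sX sY (\<lambda>v. L (xs[i := v]))"
    and C: "\<And>xs. length xs = k \<Longrightarrow> norm (L xs) \<le> C * prod_list (map norm xs)"
    using assms(3) unfolding hpoly_def bounded_multilinear_def by blast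
  obtain M D where Q: "Q = (\<lambda>x. M (replicate k x))"
    and M: "\<And>xs i. length xs = k \<Longrightarrow> i < k \<Longrightarrow> Vector_Spaces.linear sX sY (\<lambda>v. M (xs[i := v]))"
    and D: "\<And>xs. length xs = k \<Longrightarrow> norm (M xs) \<le> D * prod_list (map norm xs)"
    using assms(4) unfolding hpoly_def bounded_multilinear_def by blast
  have "norm (L xs - M xs) \<le> (C + D) * prod_list (map norm xs)" if "length xs = k" for xs
    using norm_triangle_ineq4[of "L xs" "M xs"] C[OF that] D[OF that]
    by (simp add: distrib_right)
  then have "bounded_multilinear k sX sY (\<lambda>xs. L xs - M xs)"
    unfolding bounded_multilinear_def using XY.linear_compose_sub[OF L M] by blast
  then show ?thesis
    unfolding hpoly_def P Q by blast
qed

lemma hpoly_zero_on_cball: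
  fixes sX :: "'f::rc_field \<Rightarrow> 'a::real_normed_vector \<Rightarrow> 'a"
  assumes "normed_space_over sX" "normed_space_over sY"
    and P: "P \<in> hpoly k sX sY" and 0: "\<And>x. x \<in> cball 0 1 \<Longrightarrow> P x = 0"
  shows "P x = 0"
proof -
  interpret X: normed_space_over sX by fact
  interpret Y: normed_space_over sY by fact
  obtain L where P: "P = (\<lambda>x. L (replicate k x))"
    and L: "\<And>xs i. length xs = k \<Longrightarrow> i < k \<Longrightarrow> Vector_Spaces.linear sX sY (\<lambda>v. L (xs[i := v]))"
    using P unfolding hpoly_def bounded_multilinear_def by blast
  have hom: "L (replicate j (sX c x) @ replicate (k - j) x) = sY (c ^ j) (L (replicate k x))"
    if "j \<le> k" for c x j
    using that
  proof (induction j)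
    case 0
    then show ?case by simp
  next
    case (Suc j)
    let ?xs = "replicate j (sX c x) @ replicate (k - j) x"
    have drop: "replicate (k - j) x = x # replicate (k - Suc j) x"
      using Suc.prems by (metis Suc_diff_le diff_Suc_Suc replicate_Suc)
    have upd: "?xs[j := v] = replicate j (sX c x) @ v # replicate (k - Suc j) x" for v
      by (simp add: drop list_update_append)
    interpret lin: Vector_Spaces.linear sX sY "\<lambda>v. L (?xs[j := v])"
      using Suc.prems by (intro L) auto
    have "L (replicate j (sX c x) @ sX c x # replicate (k - Suc j) x)
        = sY c (L (replicate j (sX c x) @ x # replicate (k - Suc j) x))"
      using lin.scale[of c x] by (simp only: upd)
    also have "replicate j (sX c x) @ x # replicate (k - Suc j) x = ?xs"
      by (simp only: drop)
    also have "sY c (L ?xs) = sY (c ^ Suc j) (L (replicate k x))"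
      using Suc by simp
    finally show ?case
      by (simp add: replicate_app_Cons_same)
  qed
  define c :: 'f where "c = of_real (1 / (1 + norm x))"
  have pos: "1 + norm x > 0"
    by (simp add: add_pos_nonneg)
  have "norm c = 1 / (1 + norm x)"
    unfolding c_def norm_of_real using pos by simp
  then have "norm (sX c x) = norm x / (1 + norm x)" and "c \<noteq> 0"
    using pos by (auto simp: X.norm_scale)
  then have "sX c x \<in> cball 0 1"
    using pos by (simp add: divide_le_eq)
  then have "sY (c ^ k) (P x) = 0"
    using hom[of k c x] 0 by (simp add: P)
  then show ?thesis
    using \<open>c \<noteq> 0\<close> by (simp add: Y.scale_eq_0_iff)
qed

lemma Metric_space_hpoly:
  assumes X: "normed_space_over sX" and Y: "normed_space_over sY"
  shows "Metric_space (hpoly k sX sY) (hpoly_dist k sX sY)"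
proof
  have le: "norm (R x) \<le> pnorm R" if "R \<in> hpoly k sX sY" "x \<in> cball 0 1" for R x
    unfolding pnorm_def by (rule cSUP_upper[OF that(2) bdd_above_hpoly[OF that(1)]])
  note diff = hpoly_diff[OF X Y]
  show "0 \<le> hpoly_dist k sX sY P Q" for P Q
  proof (cases "P \<in> hpoly k sX sY \<and> Q \<in> hpoly k sX sY")
    case True
    then have "norm (P 0 - Q 0) \<le> pnorm (\<lambda>x. P x - Q x)"
      using le[OF diff, of P Q 0] by simp
    then have "0 \<le> pnorm (\<lambda>x. P x - Q x)"
      using norm_ge_zero order_trans by blast
    then show ?thesis by (simp add: hpoly_dist_def)
  qed (auto simp: hpoly_dist_def)
  show "hpoly_dist k sX sY P Q = hpoly_dist k sX sY Q P" for P Q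
    by (simp add: hpoly_dist_def pnorm_def norm_minus_commute)
  show "hpoly_dist k sX sY P Q = 0 \<longleftrightarrow> P = Q"
    if "P \<in> hpoly k sX sY" "Q \<in> hpoly k sX sY" for P Q
  proof
    assume "hpoly_dist k sX sY P Q = 0"
    then have "pnorm (\<lambda>x. P x - Q x) = 0"
      using that by (simp add: hpoly_dist_def)
    then have "P x - Q x = 0" if "x \<in> cball 0 1" for x
      using le[OF diff, of P Q x] \<open>P \<in> _\<close> \<open>Q \<in> _\<close> that by simp
    then have "P x - Q x = 0" for x
      using hpoly_zero_on_cball[OF X Y diff[OF that]] by blast
    then show "P = Q" by auto
  next
    assume "P = Q"
    then show "hpoly_dist k sX sY P Q = 0"
      using that by (simp add: hpoly_dist_def pnorm_def)
  qed
  show "hpoly_dist k sX sY P R \<le> hpoly_dist k sX sY P Q + hpoly_dist k sX sY Q R"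
    if "P \<in> hpoly k sX sY" "Q \<in> hpoly k sX sY" "R \<in> hpoly k sX sY" for P Q R
  proof -
    have "norm (P x - R x) \<le> pnorm (\<lambda>x. P x - Q x) + pnorm (\<lambda>x. Q x - R x)"
      if "x \<in> cball 0 1" for x
    proof -
      have "norm (P x - R x) \<le> norm (P x - Q x) + norm (Q x - R x)"
        using norm_triangle_ineq[of "P x - Q x" "Q x - R x"] by simp
      also have "\<dots> \<le> pnorm (\<lambda>x. P x - Q x) + pnorm (\<lambda>x. Q x - R x)"
        using le[OF diff[OF \<open>P \<in> _\<close> \<open>Q \<in> _\<close>] that] le[OF diff[OF \<open>Q \<in> _\<close> \<open>R \<in> _\<close>] that]
        by simp
      finally show ?thesis .
    qed
    then have "pnorm (\<lambda>x. P x - R x) \<le> pnorm (\<lambda>x. P x - Q x) + pnorm (\<lambda>x. Q x - R x)"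
      unfolding pnorm_def[of "\<lambda>x. P x - R x"] by (intro cSUP_least) auto
    then show ?thesis
      using that by (simp add: hpoly_dist_def)
  qed
qed

lemma topspace_hpoly_topology:
  assumes "normed_space_over sX" "normed_space_over sY"
  shows "topspace (hpoly_topology k sX sY) = hpoly k sX sY"
  unfolding hpoly_topology_def
  by (rule Metric_space.topspace_mtopology[OF Metric_space_hpoly[OF assms]])

end

theory Submission
  imports Defs
begin

text \<open>
  Say that \<open>P\<close> peaks within \<open>\<epsilon>\<close> if all points of the unit ball where \<open>norm (P x)\<close> is almost maximal
  lie within \<open>\<epsilon>\<close> of the orbit of a single point under unimodular scalars. This condition is open,
  and a polynomial that peaks within every \<open>\<epsilon>\<close> strongly attains its norm. If \<open>a\<close> is one of the
  exposed points, exposed by \<open>f\<close>, and \<open>norm (P a)\<close> is almost maximal, then \<open>P + t f\<^sup>k P(a)\<close> peaks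
  near \<open>a\<close>; the Hahn-Banach theorem shows that such \<open>a\<close> exist also for vector-valued \<open>P\<close>. Iterating
  this with rapidly decreasing perturbations yields a limit that strongly attains its norm. As all
  perturbations are of the form \<open>f\<^sup>k y\<close>, the limit is visibly a polynomial, and completeness of the
  space of polynomials is not needed.

  For scalar-valued \<open>P \<noteq> 0\<close>, strong attainment implies Frechet differentiability of the norm,
  because the polynomials of norm 1 are equi-Lipschitz on the unit ball. The points of Frechet
  differentiability of any norm form a \<open>G\<^sub>\<delta>\<close> set.
\<close>

subsection \<open>The scalar field\<close>

lemma abs_rc_Re_le: "\<bar>rc_Re z\<bar> \<le> norm (z :: 'f::rc_field)"
  by (rule power2_le_imp_le) (simp_all add: rc_norm)

text \<open>The axioms do not say outright that a decomposition determines the real part. If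
  \<open>rc_i\<close> squares to -1, squaring the difference of two decompositions equates the
  square of a real with minus a square, so both vanish.\<close>

lemma rc_Re_eq: "rc_Re (of_real a + rc_i * of_real b :: 'f::rc_field) = a"
proof -
  define z :: 'f where "z = of_real a + rc_i * of_real b"
  have z: "z = of_real (rc_Re z) + of_real (rc_Im z) * rc_i"
    using rc_decomp[of z] by (simp add: scaleR_conv_of_real)
  from rc_i_cases show ?thesis
  proof
    assume "(rc_i :: 'f) = 0"
    then have "(of_real (rc_Re z) :: 'f) = of_real a"
      using z by (simp add: z_def)
    then show ?thesis by (simp add: z_def)
  next
    assume i: "(rc_i :: 'f) * rc_i = - 1"
    have "(of_real (a - rc_Re z) :: 'f) = of_real (rc_Im z - b) * rc_i"
      using z by (simp add: z_def algebra_simps)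
    then have "(of_real (a - rc_Re z) :: 'f) * of_real (a - rc_Re z)
        = of_real (rc_Im z - b) * of_real (rc_Im z - b) * (rc_i * rc_i)"
      by (simp only: ac_simps)
    then have "(of_real ((a - rc_Re z) * (a - rc_Re z)) :: 'f)
        = of_real (- ((rc_Im z - b) * (rc_Im z - b)))"
      by (simp add: i del: of_real_diff)
    then have "(a - rc_Re z)\<^sup>2 = - ((rc_Im z - b)\<^sup>2)"
      unfolding of_real_eq_iff by (simp add: power2_eq_square)
    then have "(a - rc_Re z)\<^sup>2 = 0"
      using zero_le_power2[of "a - rc_Re z"] zero_le_power2[of "rc_Im z - b"] by linarith
    then show ?thesis by (simp add: z_def)
  qed
qed

lemma rc_Re_of_real [simp]: "rc_Re (of_real a :: 'f::rc_field) = a"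
  using rc_Re_eq[of a 0, where 'f = 'f] by simp

text \<open>Passing to the pair of real and imaginary part is isometric by \<open>rc_norm\<close>,
  so Bolzano-Weierstrass in the plane applies. This supplies the compactness of the unimodular
  scalars.\<close>

lemma rc_field_convergent_subsequence:
  fixes c :: "nat \<Rightarrow> 'f::rc_field"
  assumes "bounded (range c)"
  obtains l r where "strict_mono r" "(c \<circ> r) \<longlonglongrightarrow> l"
proof -
  obtain B where B: "\<And>n. norm (c n) \<le> B"
    using assms unfolding bounded_iff by auto
  have "norm (rc_Re (c n), rc_Im (c n)) \<le> B" for n
  proof -
    have "norm (rc_Re (c n), rc_Im (c n)) = norm (c n)"
      by (simp add: norm_Pair flip: rc_norm)
    then show ?thesis using B by simp
  qed
  then have "bounded (range (\<lambda>n. (rc_Re (c n), rc_Im (c n))))"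
    unfolding bounded_iff by blast
  from bounded_imp_convergent_subsequence[OF this] obtain l r where r: "strict_mono r"
    and l: "((\<lambda>n. (rc_Re (c n), rc_Im (c n))) \<circ> r) \<longlonglongrightarrow> l"
    by blast
  have "(\<lambda>n. rc_Re (c (r n)) *\<^sub>R 1 + rc_Im (c (r n)) *\<^sub>R rc_i)
      \<longlonglongrightarrow> fst l *\<^sub>R 1 + snd l *\<^sub>R (rc_i :: 'f)"
    using tendsto_fst[OF l] tendsto_snd[OF l] by (intro tendsto_intros) (simp_all add: o_def)
  then have "(c \<circ> r) \<longlonglongrightarrow> fst l *\<^sub>R 1 + snd l *\<^sub>R rc_i"
    unfolding o_def rc_decomp[symmetric] .
  then show ?thesis using r that by blast
qed

text \<open>This lets \<open>banach_pair\<close> be interpreted with the scalar field as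
  target.\<close>

instance rc_field \<subseteq> banach
proof
  fix X :: "nat \<Rightarrow> 'a" assume X: "Cauchy X"
  obtain r l where "strict_mono r" "(X \<circ> r) \<longlonglongrightarrow> l"
    using rc_field_convergent_subsequence[OF cauchy_imp_bounded[OF X]] .
  then show "convergent X"
    using Cauchy_converges_subseq[OF X] by (auto simp: convergent_def)
qed

subsection \<open>The Hahn-Banach theorem\<close>

text \<open>The factor 1 / t gives the reverse inequality, so this is positive homogeneity in a form
  that is cheaper to verify.\<close>

definition sublinear :: "('a::real_vector \<Rightarrow> real) \<Rightarrow> bool" where
  "sublinear q \<longleftrightarrow> (\<forall>x y. q (x + y) \<le> q x + q y) \<and> (\<forall>t>0. \<forall>x. q (t *\<^sub>R x) \<le> t * q x)"

lemma sublinearD: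
  assumes "sublinear q"
  shows "q (x + y) \<le> q x + q y" and "t > 0 \<Longrightarrow> q (t *\<^sub>R x) \<le> t * q x"
    and "0 \<le> q 0" and "- q (- x) \<le> q x"
proof -
  show add: "q (x + y) \<le> q x + q y" for x y
    using assms by (simp add: sublinear_def)
  show "t > 0 \<Longrightarrow> q (t *\<^sub>R x) \<le> t * q x"
    using assms by (simp add: sublinear_def)
  show 0: "0 \<le> q 0" using add[of 0 0] by simp
  show "- q (- x) \<le> q x" using add[of x "- x"] 0 by simp
qed

text \<open>
  For \<open>q = norm\<close> the minorant encodes the value prescribed at \<open>y\<close>; for a minimal \<open>q\<close> it coincides with
  \<open>q\<close>, which forces \<open>q\<close> to be additive.
\<close>

lemma sublinear_shift:
  fixes q :: "'a::real_vector \<Rightarrow> real"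
  assumes q: "sublinear q"
  obtains m where "sublinear m" "\<And>x. m x \<le> q x" "\<And>x. m x \<le> q (x + y) - q y"
proof -
  \<comment> \<open>The choice t = 0 gives the bound by q, the choice t = 1 the bound that involves
    y.\<close>
  define m where "m x = (INF t\<in>{0..}. q (x + t *\<^sub>R y) - t * q y)" for x
  note q = sublinearD[OF q]
  \<comment> \<open>Since t y is the sum of x + t y and - x, subadditivity bounds the values below
    by - q (- x).\<close>
  have bdd: "bdd_below ((\<lambda>t. q (x + t *\<^sub>R y) - t * q y) ` {0..})" for x
  proof (rule bdd_belowI2)
    fix t :: real assume "t \<in> {0..}"
    then have "t * q y \<le> q (t *\<^sub>R y) \<or> t = 0"
      using q(2)[of "inverse t" "t *\<^sub>R y"] by (cases "t = 0") (auto simp: field_simps)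
    then show "- q (- x) \<le> q (x + t *\<^sub>R y) - t * q y"
      using q(1)[of "- x" "x + t *\<^sub>R y"] q(4)[of x] by auto
  qed
  have le: "m x \<le> q (x + t *\<^sub>R y) - t * q y" if "t \<ge> 0" for x t
    unfolding m_def using that by (intro cINF_lower bdd) simp
  have ge: "z \<le> m x" if "\<And>t. t \<ge> 0 \<Longrightarrow> z \<le> q (x + t *\<^sub>R y) - t * q y" for x z
    unfolding m_def using that by (intro cINF_greatest) auto
  have add: "m (x + x') \<le> m x + m x'" for x x'
  proof -
    have "m (x + x') - m x \<le> q (x' + t *\<^sub>R y) - t * q y" if t: "t \<ge> 0" for t
    proof -
      have "m (x + x') - (q (x' + t *\<^sub>R y) - t * q y) \<le> q (x + s *\<^sub>R y) - s * q y"
        if s: "s \<ge> 0" for s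
        using le[of "s + t" "x + x'"] s t q(1)[of "x + s *\<^sub>R y" "x' + t *\<^sub>R y"]
        by (simp add: algebra_simps)
      from ge[OF this] show ?thesis by simp
    qed
    from ge[OF this] show ?thesis by simp
  qed
  have scale: "m (s *\<^sub>R x) \<le> s * m x" if s: "s > 0" for s x
  proof -
    have "m (s *\<^sub>R x) / s \<le> q (x + t *\<^sub>R y) - t * q y" if t: "t \<ge> 0" for t
    proof -
      have "m (s *\<^sub>R x) \<le> q (s *\<^sub>R (x + t *\<^sub>R y)) - s * t * q y"
        using le[of "s * t" "s *\<^sub>R x"] s t by (simp add: scaleR_add_right)
      also have "\<dots> \<le> s * (q (x + t *\<^sub>R y) - t * q y)"
        using q(2)[OF s, of "x + t *\<^sub>R y"] by (simp add: algebra_simps)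
      finally show ?thesis using s by (simp add: divide_le_eq mult.commute)
    qed
    from ge[OF this] show ?thesis using s by (simp add: divide_le_eq mult.commute)
  qed
  show thesis
    using add scale le[of 0] le[of 1] by (intro that[of m]) (auto simp: sublinear_def)
qed

text \<open>Zorn's lemma for the reversed order. A chain is bounded by its pointwise infimum, which
  is finite because every member p satisfies - q (- x) <= - p (- x) <= p x.\<close>

lemma ex_minimal_sublinear:
  fixes q :: "'a::real_vector \<Rightarrow> real"
  assumes q: "sublinear q"
  obtains m where "sublinear m" "m \<le> q" "\<And>p. sublinear p \<Longrightarrow> p \<le> m \<Longrightarrow> p = m"
proof -
  define S where "S = {p. sublinear p \<and> p \<le> q}"
  have "\<exists>m\<in>S. \<forall>p\<in>S. m \<ge> p \<longrightarrow> p = m"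
  proof (rule predicate_Zorn)
    show "partial_order_on S (relation_of (\<ge>) S)"
      by (rule partial_order_on_relation_ofI) auto
    fix C assume C: "C \<in> Chains (relation_of (\<ge>) S)"
    show "\<exists>u\<in>S. \<forall>a\<in>C. a \<ge> u"
    proof (cases "C = {}")
      case True
      then show ?thesis using q by (auto simp: S_def)
    next
      case False
      define u where "u x = (INF p\<in>C. p x)" for x
      have CS: "sublinear p" "p x \<le> q x" if "p \<in> C" for p x
        using C that by (auto simp: Chains_def relation_of_def S_def le_fun_def)
      have tot: "p \<le> p' \<or> p' \<le> p" if "p \<in> C" "p' \<in> C" for p p'
        using C that by (auto simp: Chains_def relation_of_def)
      have bdd: "bdd_below ((\<lambda>p. p x) ` C)" for x
      proof (rule bdd_belowI2)
        fix p assume "p \<in> C"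
        then show "- q (- x) \<le> p x"
          using sublinearD(4)[OF CS(1), of p x] CS(2)[of p "- x"] by simp
      qed
      have le: "u x \<le> p x" if "p \<in> C" for p x
        unfolding u_def by (rule cINF_lower[OF bdd that])
      have ge: "z \<le> u x" if "\<And>p. p \<in> C \<Longrightarrow> z \<le> p x" for x z
        unfolding u_def by (rule cINF_greatest[OF False that])
      \<comment> \<open>An infimum of subadditive functions need not be subadditive. In a chain,
        however, p and p' lie above a common member, which gives u (x + y) <= p' x + p y.\<close>
      have add: "u (x + y) \<le> u x + u y" for x y
      proof -
        have "u (x + y) - u x \<le> p y" if p: "p \<in> C" for p
        proof -
          have "u (x + y) - p y \<le> p' x" if p': "p' \<in> C" for p'
          proof -
            obtain p'' where "p'' \<in> C" "p'' \<le> p" "p'' \<le> p'"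
              using tot[OF p p'] p p' by auto
            then show ?thesis
              using le[of p'' "x + y"] sublinearD(1)[OF CS(1), of p'' x y]
              by (smt (verit) le_fun_def)
          qed
          then have "u (x + y) - p y \<le> u x" by (rule ge)
          then show ?thesis by simp
        qed
        then have "u (x + y) - u x \<le> u y" by (rule ge)
        then show ?thesis by simp
      qed
      have "u (t *\<^sub>R x) \<le> t * u x" if t: "t > 0" for t x
      proof -
        have "u (t *\<^sub>R x) / t \<le> p x" if "p \<in> C" for p
          using le[OF that, of "t *\<^sub>R x"] sublinearD(2)[OF CS(1)[OF that] t, of x] t
          by (simp add: divide_le_eq mult.commute)
        then have "u (t *\<^sub>R x) / t \<le> u x" by (rule ge)
        then show ?thesis using t by (simp add: divide_le_eq mult.commute)
      qed
      then have "sublinear u" using add by (simp add: sublinear_def)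
      moreover have "u \<le> q"
        using False le CS(2) by (fastforce simp: le_fun_def intro: order_trans)
      ultimately show ?thesis using le by (auto simp: S_def le_fun_def)
    qed
  qed
  then obtain m where "m \<in> S" and min: "\<And>p. p \<in> S \<Longrightarrow> p \<le> m \<Longrightarrow> p = m"
    by blast
  then show thesis
    by (intro that[of m]) (auto simp: S_def intro: order_trans)
qed

text \<open>A minimal sublinear function g below q will do: by minimality it equals the minorant
  from \<open>sublinear_shift\<close>, and this is the inequality opposite to subadditivity.\<close>

lemma sublinear_dominates_linear:
  fixes q :: "'a::real_vector \<Rightarrow> real"
  assumes "sublinear q"
  obtains g where "linear g" "\<And>x. g x \<le> q x"
proof -
  obtain g where g: "sublinear g" and le: "g \<le> q"
    and min: "\<And>p. sublinear p \<Longrightarrow> p \<le> g \<Longrightarrow> p = g"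
    using ex_minimal_sublinear[OF assms] by blast
  have add: "g (x + y) = g x + g y" for x y
  proof -
    obtain m where "sublinear m" "\<And>x. m x \<le> g x" and m: "\<And>x. m x \<le> g (x + y) - g y"
      using sublinear_shift[OF g] by blast
    then have "m = g" by (intro min) (auto simp: le_fun_def)
    then show ?thesis
      using m[of x] sublinearD(1)[OF g, of x y] by simp
  qed
  have 0: "g 0 = 0" using add[of 0 0] by simp
  have minus: "g (- x) = - g x" for x
    using add[of x "- x"] 0 by simp
  have pos: "g (t *\<^sub>R x) = t * g x" if "t > 0" for t x
    using sublinearD(2)[OF g that, of x] sublinearD(2)[OF g that, of "- x"]
    by (simp add: minus)
  have "g (t *\<^sub>R x) = t * g x" for t x
    using pos[of t x] pos[of "- t" x] minus[of "t *\<^sub>R x"] 0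
    by (cases t "0 :: real" rule: linorder_cases) auto
  then have "linear g"
    by (intro linearI) (simp_all add: add)
  then show thesis using le by (intro that[of g]) (auto simp: le_fun_def)
qed

text \<open>The minorant of the norm from \<open>sublinear_shift\<close> is at most - norm y at the
  point - y, so a linear functional below it is at least norm y at y.\<close>

lemma real_norming_functional:
  fixes y :: "'a::real_normed_vector"
  obtains g :: "'a \<Rightarrow> real" where "linear g" "\<And>x. \<bar>g x\<bar> \<le> norm x" "norm y \<le> g y"
proof -
  have "sublinear (norm :: 'a \<Rightarrow> real)"
    by (auto simp: sublinear_def norm_triangle_ineq)
  then obtain m where m: "sublinear m" "\<And>x. m x \<le> norm x"
      "\<And>x. m x \<le> norm (x + y) - norm y"
    using sublinear_shift by blast
  obtain g where g: "linear g" "\<And>x. g x \<le> m x"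
    using sublinear_dominates_linear[OF m(1)] by blast
  note minus = linear_neg[OF g(1)]
  show thesis
  proof (rule that[OF g(1)])
    show "\<bar>g x\<bar> \<le> norm x" for x
      using g(2)[of x] g(2)[of "- x"] m(2)[of x] m(2)[of "- x"] by (simp add: minus)
    show "norm y \<le> g y"
      using g(2)[of "- y"] m(3)[of "- y"] by (simp add: minus)
  qed
qed

text \<open>A real norming functional h is complexified to h x - i h (i x); if \<open>rc_i\<close>
  is 0, this is h itself.\<close>

lemma (in normed_space_over) norming_functional:
  fixes y :: 'a
  obtains g :: "'a \<Rightarrow> 'f" where "Vector_Spaces.linear scale (*) g"
    "\<And>x. norm (g x) \<le> norm x" "norm y \<le> norm (g y)"
proof -
  obtain h :: "'a \<Rightarrow> real" where h: "linear h" "\<And>x. \<bar>h x\<bar> \<le> norm x" "norm y \<le> h y"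
    using real_norming_functional[of y] by blast
  note h_add = linear_add[OF h(1)] and h_scale = linear_scale[OF h(1)]
  define g :: "'a \<Rightarrow> 'f" where "g x = of_real (h x) + rc_i * of_real (- h (scale rc_i x))" for x
  have Re: "rc_Re (g x) = h x" for x
    unfolding g_def by (rule rc_Re_eq)
  have add: "g (x + x') = g x + g x'" for x x'
    by (simp add: g_def h_add scale_right_distrib algebra_simps)
  have real: "g (scale (of_real t) x) = of_real t * g x" for t x
  proof -
    have "scale rc_i (t *\<^sub>R x) = t *\<^sub>R scale rc_i x"
      using scale_left_commute[of rc_i "of_real t" x] by (simp only: scale_of_real)
    then show ?thesis
      by (simp add: g_def h_scale scale_of_real algebra_simps)
  qed
  have imag: "g (scale rc_i x) = rc_i * g x" for x
  proof (cases "(rc_i :: 'f) = 0")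
    case True
    then show ?thesis using linear_0[OF h(1)] by (simp add: g_def)
  next
    case False
    then have i: "(rc_i :: 'f) * rc_i = - 1" using rc_i_cases by blast
    have "scale rc_i (scale rc_i x) = - x"
      by (simp add: i)
    then show ?thesis
      using linear_neg[OF h(1)] by (simp add: g_def algebra_simps i flip: mult.assoc)
  qed
  have scale: "g (scale c x) = c * g x" for c x
  proof -
    have c: "c = of_real (rc_Re c) + of_real (rc_Im c) * rc_i"
      using rc_decomp[of c] by (simp add: scaleR_conv_of_real)
    have "scale c x = scale (of_real (rc_Re c)) x + scale (of_real (rc_Im c)) (scale rc_i x)"
      by (subst c) (simp add: scale_left_distrib)
    then have "g (scale c x) = of_real (rc_Re c) * g x + of_real (rc_Im c) * (rc_i * g x)"
      by (simp only: add real imag)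
    then have "g (scale c x) = (of_real (rc_Re c) + of_real (rc_Im c) * rc_i) * g x"
      by (simp add: algebra_simps)
    then show ?thesis using c by simp
  qed
  show thesis
  proof (rule that)
    show "Vector_Spaces.linear scale (*) g"
      using add scale normed_space_over.axioms(1)[OF normed_space_over_self] vector_space_axioms
      by (simp add: Vector_Spaces.linear_iff)
    show "norm (g x) \<le> norm x" for x
    proof (cases "g x = 0")
      case False
      \<comment> \<open>Rotating x by c makes the value of g real and nonnegative, hence equal to
        the value of h.\<close>
      define c where "c = of_real (norm (g x)) / g x"
      have c: "norm c = 1" using False by (simp add: c_def norm_divide)
      have "g (scale c x) = of_real (norm (g x))"
        using False by (simp add: scale c_def)
      then have "norm (g x) = h (scale c x)"
        using Re[of "scale c x"] by simp
      then show ?thesis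
        using h(2)[of "scale c x"] by (simp add: norm_scale c)
    qed simp
    show "norm y \<le> norm (g y)"
      using h(3) Re[of y] abs_rc_Re_le[of "g y"] by simp
  qed
qed

subsection \<open>Homogeneous polynomials\<close>

lemma bounded_multilinear_slot:
  assumes "bounded_multilinear k sX sY L" and "length us + Suc (length vs) = k"
  shows "Vector_Spaces.linear sX sY (\<lambda>v. L (us @ v # vs))"
proof -
  have "Vector_Spaces.linear sX sY (\<lambda>v. L ((us @ 0 # vs)[length us := v]))"
    using assms by (auto simp: bounded_multilinear_def simp del: list_update_length)
  then show ?thesis by simp
qed

text \<open>C depends on the degree alone, which later yields one Lipschitz constant for all
  polynomials. The combination of p t and p (t / 2) formed below cancels the leading term and
  multiplies the others by 1 - 2 ^ (d + 1 - i), of absolute value at least 1. The leading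
  coefficient is p 1 minus the others.\<close>

lemma polynomial_coeff_bound:
  "\<exists>C\<ge>0. \<forall>(c :: nat \<Rightarrow> 'b::real_normed_vector) M.
     (\<forall>t\<in>{0..1::real}. norm (\<Sum>i\<le>d. t ^ i *\<^sub>R c i) \<le> M) \<longrightarrow> (\<forall>i\<le>d. norm (c i) \<le> C * M)"
proof (induction d)
  case 0
  show ?case by (rule exI[of _ 1]) (auto intro: bspec[of _ _ 0])
next
  case (Suc d)
  then obtain C where C: "C \<ge> 0" and IH: "\<And>(c :: nat \<Rightarrow> 'b) M i.
      (\<And>t::real. t \<in> {0..1} \<Longrightarrow> norm (\<Sum>i\<le>d. t ^ i *\<^sub>R c i) \<le> M) \<Longrightarrow> i \<le> d \<Longrightarrow> norm (c i) \<le> C * M"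
    by blast
  define B where "B = C * (1 + 2 ^ Suc d)"
  have B: "B \<ge> 0" using C by (simp add: B_def)
  show ?case
  proof (intro exI[of _ "1 + (1 + real d) * B"] conjI allI impI)
    show "0 \<le> 1 + (1 + real d) * B" using B by simp
    fix c :: "nat \<Rightarrow> 'b" and M i
    assume *: "\<forall>t\<in>{0..1::real}. norm (\<Sum>i\<le>Suc d. t ^ i *\<^sub>R c i) \<le> M" and i: "i \<le> Suc d"
    define p where "p t = (\<Sum>i\<le>Suc d. t ^ i *\<^sub>R c i)" for t :: real
    have p: "norm (p t) \<le> M" if "t \<in> {0..1}" for t
      using * that by (simp add: p_def)
    have M: "M \<ge> 0" using p[of 0] by (smt (verit) norm_ge_zero atLeastAtMost_iff)
    \<comment> \<open>\<open>p t - 2 ^ Suc d *\<^sub>R p (t / 2)\<close> has degree at most \<open>d\<close>.\<close>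
    define e where "e i = (1 - 2 ^ (Suc d - i)) *\<^sub>R c i" for i
    have e: "(\<Sum>i\<le>d. t ^ i *\<^sub>R e i) = p t - 2 ^ Suc d *\<^sub>R p (t / 2)" for t
    proof -
      have "p t - 2 ^ Suc d *\<^sub>R p (t / 2)
          = (\<Sum>i\<le>Suc d. t ^ i *\<^sub>R c i - 2 ^ Suc d *\<^sub>R ((t / 2) ^ i *\<^sub>R c i))"
        by (simp only: p_def scaleR_sum_right sum_subtractf)
      also have "\<dots> = (\<Sum>i\<le>Suc d. t ^ i *\<^sub>R e i)"
      proof (rule sum.cong)
        fix i assume "i \<in> {..Suc d}"
        then have "(2::real) ^ Suc d = 2 ^ (Suc d - i) * 2 ^ i"
          by (simp flip: power_add)
        then have "2 ^ Suc d * (t / 2) ^ i = 2 ^ (Suc d - i) * t ^ i"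
          by (simp only:) (simp add: power_divide)
        then show "t ^ i *\<^sub>R c i - 2 ^ Suc d *\<^sub>R ((t / 2) ^ i *\<^sub>R c i) = t ^ i *\<^sub>R e i"
          unfolding e_def scaleR_scaleR by (simp add: algebra_simps flip: scaleR_left_diff_distrib)
      qed simp
      finally show ?thesis by (simp add: e_def)
    qed
    have "norm (e i) \<le> C * ((1 + 2 ^ Suc d) * M)" if "i \<le> d" for i
    proof (rule IH[OF _ that])
      fix t :: real assume t: "t \<in> {0..1}"
      have "norm (p t - 2 ^ Suc d *\<^sub>R p (t / 2)) \<le> norm (p t) + 2 ^ Suc d * norm (p (t / 2))"
        by (rule order_trans[OF norm_triangle_ineq4]) simp
      also have "\<dots> \<le> M + 2 ^ Suc d * M"
        using t by (intro add_mono mult_left_mono p) auto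
      finally show "norm (\<Sum>i\<le>d. t ^ i *\<^sub>R e i) \<le> (1 + 2 ^ Suc d) * M"
        by (simp add: e algebra_simps)
    qed
    then have e_le: "norm (e i) \<le> B * M" if "i \<le> d" for i
      using that by (simp add: B_def mult.assoc)
    have low: "norm (c i) \<le> B * M" if "i \<le> d" for i
    proof -
      have "(2::real) ^ 1 \<le> 2 ^ (Suc d - i)"
        using that by (intro power_increasing) auto
      then have "1 * norm (c i) \<le> norm (e i)"
        unfolding e_def norm_scaleR by (intro mult_right_mono) auto
      then show ?thesis using e_le[OF that] by simp
    qed
    have "norm (c (Suc d)) \<le> M + (1 + real d) * (B * M)"
    proof -
      have "c (Suc d) = p 1 - (\<Sum>i\<le>d. c i)"
        by (simp add: p_def)
      then have "norm (c (Suc d)) \<le> norm (p 1) + norm (\<Sum>i\<le>d. c i)"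
        by (simp add: norm_triangle_ineq4)
      also have "norm (\<Sum>i\<le>d. c i) \<le> of_nat (card {..d}) * (B * M)"
        using low by (intro sum_norm_bound) auto
      finally show ?thesis using p[of 1] by simp
    qed
    moreover have "B * M \<le> M + (1 + real d) * (B * M)"
      using B M by (simp add: algebra_simps)
    ultimately have "norm (c i) \<le> M + (1 + real d) * (B * M)"
      using low[of i] i by (cases "i = Suc d") auto
    then show "norm (c i) \<le> (1 + (1 + real d) * B) * M"
      by (simp add: algebra_simps)
  qed
qed

section \<open>Algebra and norm of the space of homogeneous polynomials\<close>

locale banach_pair =
  X: normed_space_over sX + Y: normed_space_over sY
  for sX :: "'f::rc_field \<Rightarrow> 'a::banach \<Rightarrow> 'a" and sY :: "'f \<Rightarrow> 'b::banach \<Rightarrow> 'b" +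
  fixes k :: nat
begin

abbreviation "HP \<equiv> hpoly k sX sY"

lemma hpoly_zero: "(\<lambda>_. 0) \<in> HP"
proof -
  have "bounded_multilinear k sX sY (\<lambda>_. 0)"
    unfolding bounded_multilinear_def
    by (auto simp: Vector_Spaces.linear_iff X.vector_space_axioms Y.vector_space_axioms
        intro: exI[of _ 0])
  then show ?thesis unfolding hpoly_def by blast
qed

lemma hpoly_minus: "P \<in> HP \<Longrightarrow> Q \<in> HP \<Longrightarrow> (\<lambda>x. P x - Q x) \<in> HP"
  by (rule hpoly_diff) unfold_locales

lemma hpoly_plus:
  assumes "P \<in> HP" "Q \<in> HP"
  shows "(\<lambda>x. P x + Q x) \<in> HP"
  using hpoly_minus[OF assms(1) hpoly_minus[OF hpoly_zero assms(2)]] by simp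

lemma hpoly_compose:
  assumes P: "P \<in> HP" and T: "Vector_Spaces.linear sY sZ T" and B: "\<And>y. norm (T y) \<le> B * norm y"
  shows "(\<lambda>x. T (P x)) \<in> hpoly k sX sZ"
proof -
  obtain L C where P: "P = (\<lambda>x. L (replicate k x))"
    and L: "\<And>xs i. length xs = k \<Longrightarrow> i < k \<Longrightarrow> Vector_Spaces.linear sX sY (\<lambda>v. L (xs[i := v]))"
    and C: "\<And>xs. length xs = k \<Longrightarrow> norm (L xs) \<le> C * prod_list (map norm xs)"
    using P unfolding hpoly_def bounded_multilinear_def by blast
  have "norm (T (L xs)) \<le> (\<bar>B\<bar> * C) * prod_list (map norm xs)" if "length xs = k" for xs
  proof -
    have "norm (T (L xs)) \<le> \<bar>B\<bar> * norm (L xs)"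
      by (rule order_trans[OF B mult_right_mono]) auto
    also have "\<dots> \<le> \<bar>B\<bar> * (C * prod_list (map norm xs))"
      by (intro mult_left_mono C that) simp
    finally show ?thesis by (simp add: mult.assoc)
  qed
  moreover have "Vector_Spaces.linear sX sZ (\<lambda>v. T (L (xs[i := v])))"
    if "length xs = k" "i < k" for xs i
    using Vector_Spaces.linear_compose[OF L[OF that] T] by (simp add: o_def)
  ultimately have "bounded_multilinear k sX sZ (\<lambda>xs. T (L xs))"
    unfolding bounded_multilinear_def by blast
  then show ?thesis
    unfolding hpoly_def P by blast
qed

lemma hpoly_scaleR: "P \<in> HP \<Longrightarrow> (\<lambda>x. r *\<^sub>R P x) \<in> HP"
proof (rule hpoly_compose[where T = "(*\<^sub>R) r" and B = "\<bar>r\<bar>"])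
  have "r *\<^sub>R sY c x = sY c (r *\<^sub>R x)" for c x
    using Y.scale_left_commute[of "of_real r" c x] by (simp only: Y.scale_of_real)
  then show "Vector_Spaces.linear sY sY ((*\<^sub>R) r)"
    by (simp add: Vector_Spaces.linear_iff Y.vector_space_axioms scaleR_add_right)
qed simp_all

lemma hpoly_homogeneous:
  assumes "P \<in> HP"
  shows "P (sX c x) = sY (c ^ k) (P x)"
proof -
  obtain L where P: "P = (\<lambda>x. L (replicate k x))" and L: "bounded_multilinear k sX sY L"
    using assms unfolding hpoly_def by blast
  have "L (replicate j (sX c x) @ ys) = sY (c ^ j) (L (replicate j x @ ys))"
    if "j + length ys = k" for j ys
    using that
  proof (induction j arbitrary: ys)
    case (Suc j)
    interpret lin: Vector_Spaces.linear sX sY "\<lambda>v. L (replicate j x @ v # ys)"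
      using Suc.prems by (intro bounded_multilinear_slot[OF L]) simp
    have "L (replicate (Suc j) (sX c x) @ ys) = L (replicate j (sX c x) @ sX c x # ys)"
      by (simp add: replicate_app_Cons_same)
    also have "\<dots> = sY (c ^ j) (L (replicate j x @ sX c x # ys))"
      using Suc.prems by (intro Suc.IH) simp
    also have "\<dots> = sY (c ^ Suc j) (L (replicate j x @ x # ys))"
      by (simp only: lin.scale Y.scale_scale power_Suc2)
    finally show ?case by (simp add: replicate_app_Cons_same)
  qed simp
  from this[of k "[]"] show ?thesis by (simp add: P)
qed

lemma norm_hpoly_unimodular: "P \<in> HP \<Longrightarrow> norm c = 1 \<Longrightarrow> norm (P (sX c x)) = norm (P x)"
  by (simp add: hpoly_homogeneous Y.norm_scale norm_power)

lemma norm_le_pnorm: "P \<in> HP \<Longrightarrow> norm x \<le> 1 \<Longrightarrow> norm (P x) \<le> pnorm P"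
  unfolding pnorm_def by (rule cSUP_upper[OF _ bdd_above_hpoly]) auto

lemma pnorm_leI: "(\<And>x. norm x \<le> 1 \<Longrightarrow> norm (P x) \<le> M) \<Longrightarrow> pnorm P \<le> M"
  unfolding pnorm_def by (rule cSUP_least) auto

lemma pnorm_nonneg: "P \<in> HP \<Longrightarrow> 0 \<le> pnorm P"
  by (rule order_trans[OF norm_ge_zero norm_le_pnorm[of P 0]]) simp_all

lemma less_pnormE:
  assumes "P \<in> HP" "M < pnorm P"
  obtains x where "norm x \<le> 1" "M < norm (P x)"
  using assms less_cSUP_iff[OF _ bdd_above_hpoly[OF assms(1)], of M]
  by (auto simp: pnorm_def)

lemma pnorm_triangle:
  assumes "P \<in> HP" "Q \<in> HP"
  shows "pnorm (\<lambda>x. P x + Q x) \<le> pnorm P + pnorm Q"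
  using assms by (intro pnorm_leI norm_triangle_mono norm_le_pnorm)

lemma pnorm_minus_commute: "pnorm (\<lambda>x. P x - Q x) = pnorm (\<lambda>x. Q x - P x)"
  by (simp add: pnorm_def norm_minus_commute)

lemma pnorm_le_add_diff:
  assumes "P \<in> HP" "Q \<in> HP"
  shows "pnorm P \<le> pnorm Q + pnorm (\<lambda>x. P x - Q x)"
  using pnorm_triangle[OF assms(2) hpoly_minus[OF assms]] by simp

lemma pnorm_zero [simp]: "pnorm (\<lambda>_. 0) = 0"
  by (simp add: pnorm_def)

lemma pnorm_scaleR:
  assumes "P \<in> HP"
  shows "pnorm (\<lambda>x. r *\<^sub>R P x) = \<bar>r\<bar> * pnorm P"
proof -
  have le: "pnorm (\<lambda>x. r *\<^sub>R P x) \<le> \<bar>r\<bar> * pnorm P" if "P \<in> HP" for P r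
    using that by (intro pnorm_leI) (auto intro!: mult_left_mono norm_le_pnorm)
  show ?thesis
  proof (cases "r = 0")
    case False
    then have "pnorm P \<le> \<bar>inverse r\<bar> * pnorm (\<lambda>x. r *\<^sub>R P x)"
      using le[OF hpoly_scaleR[OF assms, of r], of "inverse r"] by simp
    then show ?thesis
      using le[OF assms, of r] False by (auto simp: field_simps)
  qed simp
qed

section \<open>Restriction to lines and a common Lipschitz constant\<close>

text \<open>One slot is expanded at a time. The coefficients need no formula, as
  \<open>polynomial_coeff_bound\<close> estimates them from the values.\<close>

lemma hpoly_along_line:
  assumes "P \<in> HP"
  shows "\<exists>c. \<forall>t. P (x + t *\<^sub>R h) = (\<Sum>i\<le>k. t ^ i *\<^sub>R c i)"
proof -
  obtain L where P: "P = (\<lambda>x. L (replicate k x))" and L: "bounded_multilinear k sX sY L"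
    using assms unfolding hpoly_def by blast
  have "\<exists>c. \<forall>t. L (replicate j (x + t *\<^sub>R h) @ ys) = (\<Sum>i\<le>j. t ^ i *\<^sub>R c i)"
    if "j + length ys = k" for j ys
    using that
  proof (induction j arbitrary: ys)
    case (Suc j)
    obtain c where c: "\<And>t. L (replicate j (x + t *\<^sub>R h) @ x # ys) = (\<Sum>i\<le>j. t ^ i *\<^sub>R c i)"
      using Suc.IH[of "x # ys"] Suc.prems by auto
    obtain d where d: "\<And>t. L (replicate j (x + t *\<^sub>R h) @ h # ys) = (\<Sum>i\<le>j. t ^ i *\<^sub>R d i)"
      using Suc.IH[of "h # ys"] Suc.prems by auto
    \<comment> \<open>These are the coefficients of c(t) + t d(t).\<close>
    define e where "e i = (if i \<le> j then c i else 0) + (case i of 0 \<Rightarrow> 0 | Suc i \<Rightarrow> d i)" for i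
    have "L (replicate (Suc j) (x + t *\<^sub>R h) @ ys) = (\<Sum>i\<le>Suc j. t ^ i *\<^sub>R e i)" for t
    proof -
      let ?v = "x + t *\<^sub>R h"
      interpret lin: Vector_Spaces.linear sX sY "\<lambda>v. L (replicate j ?v @ v # ys)"
        using Suc.prems by (intro bounded_multilinear_slot[OF L]) simp
      have "L (replicate (Suc j) ?v @ ys) = L (replicate j ?v @ ?v # ys)"
        by (simp add: replicate_app_Cons_same)
      also have "\<dots> = L (replicate j ?v @ x # ys) + t *\<^sub>R L (replicate j ?v @ h # ys)"
        using lin.add[of x "t *\<^sub>R h"] lin.scale[of "of_real t" h]
        by (simp only: X.scale_of_real Y.scale_of_real)
      also have "\<dots> = (\<Sum>i\<le>j. t ^ i *\<^sub>R c i) + (\<Sum>i\<le>j. t ^ Suc i *\<^sub>R d i)"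
        by (simp add: c d scaleR_sum_right)
      also have "(\<Sum>i\<le>j. t ^ i *\<^sub>R c i) = (\<Sum>i\<le>Suc j. t ^ i *\<^sub>R (if i \<le> j then c i else 0))"
        by simp
      also have "(\<Sum>i\<le>j. t ^ Suc i *\<^sub>R d i)
          = (\<Sum>i\<le>Suc j. t ^ i *\<^sub>R (case i of 0 \<Rightarrow> 0 | Suc i \<Rightarrow> d i))"
        by (subst sum.atMost_Suc_shift) simp
      finally show ?thesis
        by (simp only: e_def scaleR_add_right sum.distrib)
    qed
    then show ?case by blast
  qed (auto intro: exI[of _ "\<lambda>_. L ys" for ys])
  from this[of k "[]"] show ?thesis by (simp add: P)
qed

lemma norm_hpoly_le: "P \<in> HP \<Longrightarrow> norm (P x) \<le> norm x ^ k * pnorm P"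
proof (cases "x = 0")
  case True
  assume P: "P \<in> HP"
  have "P 0 = sY (0 ^ k) (P 0)"
    using hpoly_homogeneous[OF P, of 0 0] by simp
  then show ?thesis
    using True norm_le_pnorm[OF P, of 0] by (cases "k = 0") (auto simp: power_0_left)
next
  case False
  assume P: "P \<in> HP"
  define u where "u = inverse (norm x) *\<^sub>R x"
  have x: "x = sX (of_real (norm x)) u"
    using False by (simp add: u_def X.scale_of_real del: X.scale_scale)
  have "norm u \<le> 1" using False by (simp add: u_def)
  then show ?thesis
    using norm_le_pnorm[OF P, of u] hpoly_homogeneous[OF P, of "of_real (norm x)" u]
    by (simp add: Y.norm_scale norm_power mult_left_mono flip: x)
qed

text \<open>On the unit segment from y towards x the points have norm at most 2, so P is bounded
  there by 2 ^ k times its norm, and \<open>polynomial_coeff_bound\<close> bounds its coefficients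
  along the segment. The constant term cancels in P x - P y, and s ^ i <= s for the other terms when
  s <= 1.\<close>

lemma hpoly_Lipschitz:
  obtains K where "K > 0" "\<And>P x y. P \<in> HP \<Longrightarrow> norm x \<le> 1 \<Longrightarrow> norm y \<le> 1 \<Longrightarrow>
    norm (P x - P y) \<le> K * pnorm P * norm (x - y)"
proof -
  obtain C where C: "C \<ge> 0" and coeff: "\<And>(c :: nat \<Rightarrow> 'b) M i.
      (\<And>t::real. t \<in> {0..1} \<Longrightarrow> norm (\<Sum>i\<le>k. t ^ i *\<^sub>R c i) \<le> M) \<Longrightarrow> i \<le> k \<Longrightarrow> norm (c i) \<le> C * M"
    using polynomial_coeff_bound[of k, where 'b = 'b] by blast
  \<comment> \<open>The summand 2 settles s >= 1 by the triangle inequality and keeps K positive;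
    the other counts the k nonconstant terms.\<close>
  define K where "K = 2 + real k * (C * 2 ^ k)"
  have "norm (P x - P y) \<le> K * pnorm P * norm (x - y)"
    if P: "P \<in> HP" and x: "norm x \<le> 1" and y: "norm y \<le> 1" for P x y
  proof -
    define s where "s = norm (x - y)"
    note nn = pnorm_nonneg[OF P]
    consider "s = 0" | "s \<ge> 1" | "0 < s" "s \<le> 1"
      unfolding s_def by (metis linorder_le_cases norm_ge_zero order_le_less)
    then show ?thesis
    proof cases
      case 1
      then show ?thesis by (simp add: s_def)
    next
      case 2
      have "norm (P x - P y) \<le> pnorm P + pnorm P"
        using norm_le_pnorm[OF P x] norm_le_pnorm[OF P y]
        by (rule order_trans[OF norm_triangle_ineq4 add_mono])
      also have "\<dots> \<le> K * pnorm P * 1"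
        using C nn by (simp add: K_def algebra_simps)
      also have "\<dots> \<le> K * pnorm P * s"
        using 2 C nn by (intro mult_left_mono) (auto simp: K_def)
      finally show ?thesis by (simp add: s_def)
    next
      case 3
      define h where "h = inverse s *\<^sub>R (x - y)"
      have h: "norm h = 1" using 3 by (simp add: h_def s_def)
      have xh: "x = y + s *\<^sub>R h" using 3 by (simp add: h_def)
      obtain c where c: "\<And>t. P (y + t *\<^sub>R h) = (\<Sum>i\<le>k. t ^ i *\<^sub>R c i)"
        using hpoly_along_line[OF P] by blast
      have c_le: "norm (c i) \<le> C * (2 ^ k * pnorm P)" if "i \<le> k" for i
      proof (rule coeff[OF _ that])
        fix t :: real assume t: "t \<in> {0..1}"
        have "norm (y + t *\<^sub>R h) \<le> 1 + 1"
          using t y h by (intro norm_triangle_mono) auto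
        then have "norm (y + t *\<^sub>R h) ^ k \<le> 2 ^ k"
          by (intro power_mono) auto
        then have "norm (P (y + t *\<^sub>R h)) \<le> 2 ^ k * pnorm P"
          using norm_hpoly_le[OF P, of "y + t *\<^sub>R h"] nn
          by (meson mult_right_mono order_trans)
        then show "norm (\<Sum>i\<le>k. t ^ i *\<^sub>R c i) \<le> 2 ^ k * pnorm P"
          by (simp add: c)
      qed
      have "P x - P y = (\<Sum>i\<le>k. s ^ i *\<^sub>R c i) - (\<Sum>i\<le>k. 0 ^ i *\<^sub>R c i)"
        using c[of s] c[of 0] xh by simp
      also have "\<dots> = (\<Sum>i\<in>{1..k}. s ^ i *\<^sub>R c i)"
        by (auto simp: atMost_atLeast0 sum.atLeast_Suc_atMost intro!: sum.neutral)
      finally have "norm (P x - P y) \<le> of_nat (card {1..k}) * (s * (C * (2 ^ k * pnorm P)))"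
      proof (simp only:, intro sum_norm_bound)
        fix i assume i: "i \<in> {1..k}"
        have "s ^ i \<le> s ^ 1"
          using 3 i by (intro power_decreasing) auto
        then show "norm (s ^ i *\<^sub>R c i) \<le> s * (C * (2 ^ k * pnorm P))"
          using 3 i c_le[of i] by (auto intro!: mult_mono)
      qed
      also have "\<dots> \<le> K * pnorm P * s"
        using 3 nn by (simp add: K_def algebra_simps)
      finally show ?thesis by (simp add: s_def)
    qed
  qed
  moreover have "K > 0" using C by (simp add: K_def add_pos_nonneg)
  ultimately show thesis using that by blast
qed

section \<open>Powers of functionals and their series\<close>

definition contraction_functional :: "('a \<Rightarrow> 'f) \<Rightarrow> bool" where
  "contraction_functional f \<longleftrightarrow> Vector_Spaces.linear sX (*) f \<and> (\<forall>x. norm (f x) \<le> norm x)"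

lemma contraction_functional_prod_list:
  assumes f: "contraction_functional f"
  shows "i < length xs \<Longrightarrow> Vector_Spaces.linear sX (*) (\<lambda>v. prod_list (map f (xs[i := v])))"
    and "norm (prod_list (map f xs)) \<le> prod_list (map norm xs)"
proof -
  show "Vector_Spaces.linear sX (*) (\<lambda>v. prod_list (map f (xs[i := v])))" if "i < length xs"
    using f that unfolding contraction_functional_def
    by (simp add: Vector_Spaces.linear_iff upd_conv_take_nth_drop algebra_simps)
  show "norm (prod_list (map f xs)) \<le> prod_list (map norm xs)"
    using f by (induction xs)
      (auto simp: contraction_functional_def norm_mult intro!: mult_mono)
qed

text \<open>Each term is the diagonal of the k-linear map that sends xs to \<open>T xs n\<close>.
  The series of these maps converges absolutely, with the sum of the \<open>norm (y n)\<close> as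
  bound, and its sum is again k-linear.\<close>

lemma hpoly_suminf:
  assumes f: "\<And>n. contraction_functional (f n)" and y: "summable (\<lambda>n. norm (y n))"
  shows "(\<lambda>x. \<Sum>n. sY (f n x ^ k) (y n)) \<in> HP"
proof -
  define T where "T xs n = sY (prod_list (map (f n) xs)) (y n)" for xs n
  have T: "norm (T xs n) \<le> prod_list (map norm xs) * norm (y n)" for xs n
    unfolding T_def Y.norm_scale
    by (intro mult_right_mono contraction_functional_prod_list(2) f) simp
  note summ = summable_mult[OF y]
  have sum_T: "summable (T xs)" for xs
    by (rule summable_comparison_test'[OF summ T])
  have "Vector_Spaces.linear sX sY (\<lambda>v. suminf (T (xs[i := v])))" if i: "i < length xs" for xs i
  proof -
    have lin: "Vector_Spaces.linear sX (*) (\<lambda>v. prod_list (map (f n) (xs[i := v])))" for n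
      by (rule contraction_functional_prod_list(1)[OF f i])
    have add: "T (xs[i := u + v]) = (\<lambda>n. T (xs[i := u]) n + T (xs[i := v]) n)" for u v
      using lin by (simp add: T_def fun_eq_iff Vector_Spaces.linear_iff Y.scale_left_distrib)
    have scale: "T (xs[i := sX c v]) = (\<lambda>n. sY c (T (xs[i := v]) n))" for c v
      using lin by (simp add: T_def fun_eq_iff Vector_Spaces.linear_iff)
    have blin: "bounded_linear (sY c)" for c
    proof (rule bounded_linear_intro)
      show "sY c (r *\<^sub>R x) = r *\<^sub>R sY c x" for r x
        using Y.scale_left_commute[of "of_real r" c x] by (simp only: Y.scale_of_real)
      show "norm (sY c x) \<le> norm x * norm c" for x
        by (simp add: Y.norm_scale)
    qed (rule Y.scale_right_distrib)
    show ?thesis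
      unfolding Vector_Spaces.linear_iff add scale
      using suminf_add[OF sum_T sum_T] bounded_linear.suminf[OF blin sum_T]
        X.vector_space_axioms Y.vector_space_axioms
      by simp
  qed
  moreover have "norm (suminf (T xs)) \<le> (\<Sum>n. norm (y n)) * prod_list (map norm xs)" for xs
    using norm_suminf_le[OF T[of xs] summ]
    by (simp only: suminf_mult[OF y] mult.commute[of "suminf (\<lambda>n. norm (y n))"])
  ultimately have "bounded_multilinear k sX sY (\<lambda>xs. suminf (T xs))"
    unfolding bounded_multilinear_def by blast
  moreover have "(\<Sum>n. sY (f n x ^ k) (y n)) = suminf (T (replicate k x))" for x
    by (simp add: T_def[abs_def] prod_list_replicate)
  ultimately show ?thesis unfolding hpoly_def by auto
qed

lemma hpoly_functional_power:
  assumes "contraction_functional f"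
  shows "(\<lambda>x. sY (f x ^ k) y) \<in> HP"
proof -
  have "(\<Sum>n::nat. sY (f x ^ k) (if n = 0 then y else 0)) = sY (f x ^ k) y" for x
    by (subst suminf_finite[of "{0}"]) auto
  moreover have "summable (\<lambda>n::nat. norm (if n = 0 then y else 0))"
    by (rule summable_finite[of "{0}"]) auto
  ultimately show ?thesis
    using hpoly_suminf[of "\<lambda>_. f" "\<lambda>n. if n = 0 then y else 0"] assms by simp
qed

lemma norm_functional_power_le:
  assumes "contraction_functional f" "norm x \<le> 1"
  shows "norm (sY (f x ^ k) y) \<le> norm y"
proof -
  have "norm (f x) \<le> 1"
    using assms order_trans by (auto simp: contraction_functional_def)
  then have "norm (f x) ^ k * norm y \<le> 1 * norm y"
    by (intro mult_right_mono power_le_one) auto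
  then show ?thesis by (simp add: Y.norm_scale norm_power)
qed

subsection \<open>Density of the strongly norm attaining polynomials\<close>

text \<open>The uniformity is kept in that d serves all points of A: below, d is fixed first and a
  is chosen depending on it.\<close>

lemma uniformly_strongly_exposedE:
  assumes "uniformly_strongly_exposed sX A" "e > 0"
  obtains d where "d > 0"
    "\<And>a. a \<in> A \<Longrightarrow> \<exists>f. contraction_functional f \<and> f a = 1 \<and>
      (\<forall>x. norm x \<le> 1 \<and> rc_Re (f x) \<ge> 1 - d \<longrightarrow> norm (x - a) \<le> e)"
proof -
  obtain \<delta> and f :: "'a \<Rightarrow> 'a \<Rightarrow> 'f" where \<delta>: "\<And>e. e > 0 \<Longrightarrow> \<delta> e > (0::real)"
    and f: "\<And>a. a \<in> A \<Longrightarrow> bounded_functional sX (f a) \<and> onorm (f a) = 1 \<and> f a a = 1 \<and>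
        (\<forall>e>0. \<forall>x. norm x \<le> 1 \<and> rc_Re (f a x) \<ge> 1 - \<delta> e \<longrightarrow> norm (x - a) \<le> e)"
    using assms(1) unfolding uniformly_strongly_exposed_def by blast
  have "contraction_functional (f a)" if "a \<in> A" for a
    unfolding contraction_functional_def
  proof (intro conjI allI)
    show "norm (f a x) \<le> norm x" for x
      using f[OF that] onorm[of "f a" x] by (simp add: bounded_functional_def)
    show "Vector_Spaces.linear sX (*) (f a)"
      using f[OF that] by (simp add: bounded_functional_def)
  qed
  then show thesis
    using \<delta>[OF assms(2)] f assms(2) by (intro that[of "\<delta> e"]) blast+
qed

text \<open>Composing P with a functional that norms an almost maximal value P x reduces this to the
  scalar case.\<close>

lemma norming_vector_valued:
  assumes norming: "norming_for_hpoly k sX A" and A: "A \<noteq> {}"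
    and P: "P \<in> HP" and M: "M < pnorm P"
  obtains a where "a \<in> A" "M < norm (P a)"
proof -
  obtain x where x: "norm x \<le> 1" "M < norm (P x)"
    using less_pnormE[OF P M] .
  obtain g where g: "Vector_Spaces.linear sY (*) g" "\<And>y. norm (g y) \<le> norm y"
    "norm (P x) \<le> norm (g (P x))"
    using Y.norming_functional[of "P x"] by blast
  have gP: "(\<lambda>x. g (P x)) \<in> hpoly k sX (*)"
    using g by (intro hpoly_compose[OF P, where B = 1]) auto
  have "norm (g (P x)) \<le> pnorm (\<lambda>x. g (P x))"
    unfolding pnorm_def using x by (intro cSUP_upper[OF _ bdd_above_hpoly[OF gP]]) auto
  then have "M < (SUP a\<in>A. norm (g (P a)))"
    using norming gP x g(3) by (auto simp: norming_for_hpoly_def)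
  then obtain a where "a \<in> A" "M < norm (g (P a))"
    using less_cSupD[of "(\<lambda>a. norm (g (P a))) ` A" M] A by auto
  then show thesis
    using g(2)[of "P a"] by (intro that[of a]) auto
qed

section \<open>Peaking polynomials\<close>

definition peaks_within :: "('a \<Rightarrow> 'b) \<Rightarrow> real \<Rightarrow> bool" where
  "peaks_within P e \<longleftrightarrow> (\<exists>a. \<exists>\<eta>>0. \<forall>x. norm x \<le> 1 \<longrightarrow> pnorm P - \<eta> < norm (P x) \<longrightarrow>
    (\<exists>c. norm c = 1 \<and> norm (x - sX c a) \<le> e))"

lemma peaks_within_mono: "peaks_within P d \<Longrightarrow> d \<le> e \<Longrightarrow> peaks_within P e"
  unfolding peaks_within_def by (meson order_trans)

text \<open>The centre a stays the same. Replacing P by R moves the norm and each value by at most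
  \<open>\<eta> / 3\<close>, so the slice of R of width \<open>\<eta> / 3\<close> lies in that of P
  of width \<open>\<eta>\<close>.\<close>

lemma peaks_within_open:
  assumes P: "P \<in> HP" and "peaks_within P e"
  obtains r where "r > 0" "\<And>R. R \<in> HP \<Longrightarrow> pnorm (\<lambda>x. R x - P x) \<le> r \<Longrightarrow> peaks_within R e"
proof -
  obtain a \<eta> where \<eta>: "\<eta> > 0" and a: "\<And>x. norm x \<le> 1 \<Longrightarrow> pnorm P - \<eta> < norm (P x) \<Longrightarrow>
      \<exists>c. norm c = 1 \<and> norm (x - sX c a) \<le> e"
    using assms(2) unfolding peaks_within_def by blast
  show thesis
  proof (rule that[of "\<eta> / 3"])
    show "\<eta> / 3 > 0" using \<eta> by simp
    fix R assume R: "R \<in> HP" and le: "pnorm (\<lambda>x. R x - P x) \<le> \<eta> / 3"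
    have "\<exists>c. norm c = 1 \<and> norm (x - sX c a) \<le> e"
      if x: "norm x \<le> 1" "pnorm R - \<eta> / 3 < norm (R x)" for x
    proof (rule a[OF x(1)])
      have "pnorm P \<le> pnorm R + \<eta> / 3"
        using pnorm_le_add_diff[OF P R] le pnorm_minus_commute[of P R] by simp
      moreover have "norm (R x) \<le> norm (P x) + \<eta> / 3"
        using norm_le_pnorm[OF hpoly_minus[OF R P] x(1)] le norm_triangle_sub[of "R x" "P x"]
        by simp
      ultimately show "pnorm P - \<eta> < norm (P x)" using x(2) by simp
    qed
    then show "peaks_within R e"
      unfolding peaks_within_def using \<eta> by (intro exI[of _ a] exI[of _ "\<eta> / 3"]) auto
  qed
qed

text \<open>The perturbation t f^k P(a) lifts the norm almost to (1 + t) N, while the value at x has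
  norm at most N (1 + t |f x|^k). An almost maximal x thus has |f x| near 1, and after a rotation it
  lies in the slice that f cuts off at a.\<close>

lemma peaks_within_perturbation:
  assumes A: "uniformly_strongly_exposed sX A" "norming_for_hpoly k sX A" "A \<noteq> {}"
    and k: "k \<ge> 1" and P: "P \<in> HP" "pnorm P > 0" and e: "e > 0" and s: "s > 0"
  obtains f y where "contraction_functional f" "norm y \<le> s"
    "peaks_within (\<lambda>x. P x + sY (f x ^ k) y) e"
proof -
  obtain d' where d': "d' > 0" and exposed: "\<And>a. a \<in> A \<Longrightarrow> \<exists>f. contraction_functional f \<and> f a = 1 \<and>
      (\<forall>x. norm x \<le> 1 \<and> rc_Re (f x) \<ge> 1 - d' \<longrightarrow> norm (x - a) \<le> e)"
    using uniformly_strongly_exposedE[OF A(1) e] by blast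
  \<comment> \<open>The bound 1 keeps 1 - d / 2 positive, so that \<open>f x\<close> will be nonzero
    and can be rotated.\<close>
  define d where "d = min d' 1"
  have d: "d > 0" "d \<le> 1" "d \<le> d'" using d' by (auto simp: d_def)
  define N where "N = pnorm P"
  \<comment> \<open>This makes the norm of t P(a) at most s.\<close>
  define t where "t = s / N"
  have N: "N > 0" and t: "t > 0" using P s by (auto simp: N_def t_def)
  \<comment> \<open>The choice of a loses (1 + t) \<open>\<theta>\<close> = t N d / 4 and that of x
    loses \<open>\<eta>\<close> = t N d / 4; together they leave |f x|^k > 1 - d / 2.\<close>
  define \<theta> where "\<theta> = t * N * d / (4 * (1 + t))"
  define \<eta> where "\<eta> = t * N * d / 4"
  have \<theta>: "\<theta> > 0" and \<eta>: "\<eta> > 0" using N t d by (auto simp: \<theta>_def \<eta>_def)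
  have \<theta>_eq: "(1 + t) * \<theta> = t * N * d / 4"
    using t by (simp add: \<theta>_def divide_simps)
  obtain a where a: "a \<in> A" "N - \<theta> < norm (P a)"
    using norming_vector_valued[OF A(2,3) P(1), of "N - \<theta>"] \<theta> by (auto simp: N_def)
  have norm_a: "norm a = 1"
    using A(1) a(1) by (auto simp: uniformly_strongly_exposed_def)
  obtain f where f: "contraction_functional f" "f a = 1"
    and near: "\<And>x. norm x \<le> 1 \<Longrightarrow> rc_Re (f x) \<ge> 1 - d' \<Longrightarrow> norm (x - a) \<le> e"
    using exposed[OF a(1)] by blast
  have f_scale: "f (sX c x) = c * f x" for c x
    using f(1) by (simp add: contraction_functional_def Vector_Spaces.linear_iff)
  define y where "y = t *\<^sub>R P a"
  define Q where "Q x = P x + sY (f x ^ k) y" for x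
  have Q: "Q \<in> HP"
    unfolding Q_def by (intro hpoly_plus P hpoly_functional_power f)
  have Pa: "norm (P a) \<le> N"
    unfolding N_def using norm_a by (intro norm_le_pnorm P) simp
  have "Q a = (1 + t) *\<^sub>R P a"
    by (simp add: Q_def f y_def scaleR_add_left)
  then have "(1 + t) * norm (P a) \<le> pnorm Q"
    using norm_le_pnorm[OF Q, of a] norm_a t by simp
  moreover have "(1 + t) * (N - \<theta>) \<le> (1 + t) * norm (P a)"
    using a(2) t by (intro mult_left_mono) auto
  ultimately have pQ: "(1 + t) * N - t * N * d / 4 \<le> pnorm Q"
    using \<theta>_eq by (simp add: algebra_simps)
  have "\<exists>c. norm c = 1 \<and> norm (x - sX c a) \<le> e"
    if x: "norm x \<le> 1" "pnorm Q - \<eta> < norm (Q x)" for x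
  proof -
    define \<phi> where "\<phi> = norm (f x)"
    have \<phi>: "0 \<le> \<phi>" "\<phi> \<le> 1"
      using f(1) x(1) by (auto simp: \<phi>_def contraction_functional_def intro: order_trans)
    have "norm (sY (f x ^ k) y) = t * (\<phi> ^ k * norm (P a))"
      using t by (simp add: Y.norm_scale norm_power y_def \<phi>_def)
    also have "\<dots> \<le> t * (\<phi> ^ k * N)"
      using t \<phi> Pa by (intro mult_left_mono) auto
    finally have "norm (Q x) \<le> N + t * (\<phi> ^ k * N)"
      using norm_le_pnorm[OF P(1) x(1)] unfolding Q_def N_def
      by (intro norm_triangle_mono)
    then have "t * N * (1 - d / 2) < t * N * \<phi> ^ k"
      using x(2) pQ by (simp add: \<eta>_def algebra_simps)
    then have "1 - d / 2 < \<phi> ^ k"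
      using t N by (simp add: mult_less_cancel_left_pos)
    \<comment> \<open>Here k >= 1 enters.\<close>
    also have "\<phi> ^ k \<le> \<phi> ^ 1"
      using k \<phi> by (intro power_decreasing) auto
    finally have \<phi>_gt: "1 - d / 2 < \<phi>" by simp
    then have "\<phi> > 0" using d by simp
    then have fx: "f x \<noteq> 0" by (auto simp: \<phi>_def)
    define c where "c = of_real \<phi> / f x"
    have c: "norm c = 1" "c \<noteq> 0"
      using fx \<phi>(1) by (auto simp: c_def norm_divide \<phi>_def)
    have "f (sX c x) = of_real \<phi>"
      using fx by (simp add: f_scale c_def)
    then have "norm (sX c x - a) \<le> e"
      using \<phi>_gt d x(1) c by (intro near) (auto simp: X.norm_scale)
    moreover have "x - sX (inverse c) a = sX (inverse c) (sX c x - a)"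
      using c by (simp add: X.scale_right_diff_distrib)
    ultimately have "norm (x - sX (inverse c) a) \<le> e"
      using c by (simp add: X.norm_scale norm_inverse)
    then show ?thesis
      using c by (intro exI[of _ "inverse c"]) (simp add: norm_inverse)
  qed
  then have "peaks_within Q e"
    unfolding peaks_within_def using \<eta> by blast
  moreover have "norm y \<le> s"
  proof -
    have "norm y \<le> t * N" using t Pa by (simp add: y_def)
    then show ?thesis using N by (simp add: t_def)
  qed
  ultimately show thesis
    using f(1) by (intro that[of f y]) (simp_all add: Q_def[abs_def])
qed

lemma unimodular_orbit_near:
  assumes "norm c = 1" "norm (x - sX c a) \<le> e" "norm d = 1" "norm (y - sX d a) \<le> e"
  obtains u where "norm u = 1" "norm (y - sX u x) \<le> 2 * e"
proof
  show u: "norm (d / c) = 1" using assms by (simp add: norm_divide)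
  have "c \<noteq> 0" using assms(1) by auto
  then have "y - sX (d / c) x = (y - sX d a) - sX (d / c) (x - sX c a)"
    by (simp add: X.scale_right_diff_distrib)
  also have "norm \<dots> \<le> norm (y - sX d a) + norm (x - sX c a)"
    using norm_triangle_ineq4[of "y - sX d a" "sX (d / c) (x - sX c a)"] u
    by (simp only: X.norm_scale mult_1_left)
  also have "\<dots> \<le> e + e"
    using assms by (intro add_mono)
  finally show "norm (y - sX (d / c) x) \<le> 2 * e" by simp
qed

text \<open>Along a maximizing sequence the points approach the orbit of z, and the unimodular
  factors have a convergent subsequence.\<close>

lemma strongly_attains_normI:
  assumes P: "P \<in> HP"
    and near: "\<And>e. e > 0 \<Longrightarrow> \<exists>\<eta>>0. \<forall>x. norm x \<le> 1 \<longrightarrow> pnorm P - \<eta> < norm (P x) \<longrightarrow>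
      (\<exists>c. norm c = 1 \<and> norm (x - sX c z) < e)"
  shows "strongly_attains_norm sX P"
  unfolding strongly_attains_norm_def strongly_attains_norm_at_def
proof (intro exI[of _ z] allI impI, elim conjE)
  fix x :: "nat \<Rightarrow> 'a"
  assume x: "\<forall>n. x n \<in> cball 0 1" and lim: "(\<lambda>n. norm (P (x n))) \<longlonglongrightarrow> pnorm P"
  have "\<exists>m0. \<forall>m\<ge>m0. \<exists>c. norm c = 1 \<and> norm (x m - sX c z) < inverse (Suc n)" for n
  proof -
    obtain \<eta> where \<eta>: "\<eta> > 0" "\<And>x. norm x \<le> 1 \<Longrightarrow> pnorm P - \<eta> < norm (P x) \<Longrightarrow>
        \<exists>c. norm c = 1 \<and> norm (x - sX c z) < inverse (Suc n)"
      using near[of "inverse (Suc n)"] by auto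
    have "\<forall>\<^sub>F m in sequentially. pnorm P - \<eta> < norm (P (x m))"
      using \<eta>(1) by (intro order_tendstoD(1)[OF lim]) simp
    then have "\<forall>\<^sub>F m in sequentially. \<exists>c. norm c = 1 \<and> norm (x m - sX c z) < inverse (Suc n)"
      by (rule eventually_mono) (use \<eta>(2) x in simp)
    then show ?thesis
      by (simp only: eventually_sequentially)
  qed
  then obtain m0 where m0: "\<And>n m. m \<ge> m0 n \<Longrightarrow>
      \<exists>c. norm c = 1 \<and> norm (x m - sX c z) < inverse (Suc n)"
    by metis
  \<comment> \<open>The sum makes r dominate \<open>m0\<close>, and the summand n makes it strictly
    increasing.\<close>
  define r where "r n = n + (\<Sum>i\<le>n. m0 i)" for n
  have r: "strict_mono r" by (simp add: strict_mono_Suc_iff r_def)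
  have "m0 n \<le> r n" for n
    using member_le_sum[of n "{..n}" m0] by (simp add: r_def)
  then have "\<exists>c. norm c = 1 \<and> norm (x (r n) - sX c z) < inverse (Suc n)" for n
    by (rule m0)
  then obtain c where c: "\<And>n. norm (c n) = 1" "\<And>n. norm (x (r n) - sX (c n) z) < inverse (Suc n)"
    by metis
  have "bounded (range c)"
    unfolding bounded_iff using c(1) by (auto intro: exI[of _ 1])
  then obtain l q where q: "strict_mono q" and l: "(c \<circ> q) \<longlonglongrightarrow> l"
    using rc_field_convergent_subsequence by blast
  have "norm l = 1"
    using tendsto_norm[OF l] c(1) by (simp add: o_def LIMSEQ_const_iff)
  have 1: "(\<lambda>n. norm (x (r n) - sX (c n) z)) \<longlonglongrightarrow> 0"
    using c(2) by (intro tendsto_sandwich[OF _ _ tendsto_const LIMSEQ_inverse_real_of_nat])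
      (auto intro!: always_eventually less_imp_le)
  have 2: "(\<lambda>n. norm (c (q n) - l) * norm z) \<longlonglongrightarrow> 0 * norm z"
    using l by (intro tendsto_mult tendsto_const tendsto_norm_zero)
      (simp add: o_def LIM_zero_iff)
  have "(\<lambda>n. norm (x (r (q n)) - sX l z)) \<longlonglongrightarrow> 0"
  proof (rule tendsto_sandwich[OF _ _ tendsto_const])
    show "(\<lambda>n. norm (x (r (q n)) - sX (c (q n)) z) + norm (c (q n) - l) * norm z) \<longlonglongrightarrow> 0"
      using tendsto_add[OF LIMSEQ_subseq_LIMSEQ[OF 1 q] 2] by (simp add: o_def)
    have "norm (x (r (q n)) - sX l z)
        \<le> norm (x (r (q n)) - sX (c (q n)) z) + norm (sX (c (q n)) z - sX l z)" for n
      using norm_triangle_ineq[of "x (r (q n)) - sX (c (q n)) z" "sX (c (q n)) z - sX l z"] by simp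
    then show "\<forall>\<^sub>F n in sequentially. norm (x (r (q n)) - sX l z)
        \<le> norm (x (r (q n)) - sX (c (q n)) z) + norm (c (q n) - l) * norm z"
      by (simp add: X.norm_scale flip: X.scale_left_diff_distrib)
  qed simp
  then have "(x \<circ> (r \<circ> q)) \<longlonglongrightarrow> sX l z"
    by (simp add: o_def LIM_zero_iff tendsto_norm_zero_iff)
  then show "\<exists>r c. strict_mono r \<and> norm c = 1 \<and> (x \<circ> r) \<longlonglongrightarrow> sX c z"
    using strict_mono_o[OF r q] \<open>norm l = 1\<close> by blast
qed

text \<open>The centres for different e are unrelated, but the slices \<open>S n\<close> are nested,
  and any two points of \<open>S n\<close> agree up to a rotation and an error of 2 e n. Rotating a
  point of each slice towards the previous one gives a Cauchy sequence; its limit is the point of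
  strong attainment.\<close>

lemma strongly_attains_norm_if_peaks:
  assumes P: "P \<in> HP" and peaks: "\<And>e. e > 0 \<Longrightarrow> peaks_within P e"
  shows "strongly_attains_norm sX P"
proof -
  define N where "N = pnorm P"
  define e where "e n = (1 / 2 :: real) ^ n" for n
  have "\<exists>a \<eta>. \<eta> > 0 \<and> (\<forall>x. norm x \<le> 1 \<longrightarrow> N - \<eta> < norm (P x) \<longrightarrow>
    (\<exists>c. norm c = 1 \<and> norm (x - sX c a) \<le> e n))" for n
    using peaks[of "e n"] unfolding peaks_within_def N_def e_def by auto
  then obtain a \<eta> where \<eta>: "\<And>n. \<eta> n > 0" and a: "\<And>n x. norm x \<le> 1 \<Longrightarrow> N - \<eta> n < norm (P x) \<Longrightarrow>
      \<exists>c. norm c = 1 \<and> norm (x - sX c (a n)) \<le> e n"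
    by metis
  define S where "S n = {x. norm x \<le> 1 \<and> (\<forall>j\<le>n. N - \<eta> j < norm (P x))}" for n
  have S_near: "\<exists>u. norm u = 1 \<and> norm (y - sX u x) \<le> 2 * e n" if "x \<in> S n" "y \<in> S n" for x y n
    using a[of x n] a[of y n] that unimodular_orbit_near
    by (simp add: S_def) (metis order_refl)
  have S_nonempty: "\<exists>x. x \<in> S n" for n
  proof -
    define m where "m = Min (\<eta> ` {..n})"
    have "m > 0" and m: "\<And>j. j \<le> n \<Longrightarrow> m \<le> \<eta> j" using \<eta> by (auto simp: m_def)
    then obtain x where "norm x \<le> 1" "N - m < norm (P x)"
      using less_pnormE[OF P, of "N - m"] by (auto simp: N_def)
    then have "x \<in> S n" using m by (fastforce simp: S_def)
    then show ?thesis ..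
  qed
  have "\<exists>z. \<forall>n. z n \<in> S n \<and> norm (z (Suc n) - z n) \<le> 2 * e n"
  proof (rule dependent_nat_choice)
    show "\<exists>x. x \<in> S 0" by (rule S_nonempty)
    fix x n assume x: "x \<in> S n"
    obtain w where w: "w \<in> S (Suc n)" using S_nonempty by blast
    then have "w \<in> S n" by (auto simp: S_def)
    then obtain u where "norm u = 1" "norm (x - sX u w) \<le> 2 * e n"
      using S_near[OF _ x] by blast
    \<comment> \<open>Slices are invariant under unimodular scalars.\<close>
    moreover from this(1) have "sX u w \<in> S (Suc n)"
      using w by (simp add: S_def X.norm_scale norm_hpoly_unimodular[OF P])
    ultimately show "\<exists>y. y \<in> S (Suc n) \<and> norm (y - x) \<le> 2 * e n"
      by (auto simp: norm_minus_commute)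
  qed
  then obtain z where zS: "\<And>n. z n \<in> S n" and z: "\<And>n. norm (z (Suc n) - z n) \<le> 2 * e n"
    by blast
  have "summable (\<lambda>n. 2 * e n)"
    unfolding e_def by (intro summable_mult summable_geometric) simp
  then have "summable (\<lambda>n. z (Suc n) - z n)"
    by (rule summable_comparison_test'[where N = 0]) (rule z)
  then have "convergent (\<lambda>n. z n - z 0)"
    by (simp add: summable_iff_convergent sum_lessThan_telescope)
  then have "convergent z"
    by (simp add: convergent_diff_const_right_iff)
  then obtain l where l: "z \<longlonglongrightarrow> l" by (auto simp: convergent_def)
  show ?thesis
  proof (rule strongly_attains_normI[OF P])
    fix \<epsilon> :: real assume \<epsilon>: "\<epsilon> > 0"
    have "(\<lambda>n. 2 * e n + norm (z n - l)) \<longlonglongrightarrow> 2 * 0 + 0"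
      unfolding e_def using l
      by (intro tendsto_intros tendsto_norm_zero LIMSEQ_power_zero) (auto simp: LIM_zero_iff)
    then have "\<forall>\<^sub>F n in sequentially. 2 * e n + norm (z n - l) < \<epsilon>"
      using \<epsilon> by (intro order_tendstoD(2)) auto
    then obtain n where n: "2 * e n + norm (z n - l) < \<epsilon>"
      by (auto simp: eventually_sequentially)
    have "\<exists>c. norm c = 1 \<and> norm (x - sX c l) < \<epsilon>" if x: "x \<in> S n" for x
    proof -
      obtain u where u: "norm u = 1" "norm (x - sX u (z n)) \<le> 2 * e n"
        using S_near[OF zS x] by blast
      have "norm (x - sX u l) \<le> norm (x - sX u (z n)) + norm (sX u (z n - l))"
        using norm_triangle_ineq[of "x - sX u (z n)" "sX u (z n - l)"]
        by (simp add: X.scale_right_diff_distrib)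
      then have "norm (x - sX u l) \<le> 2 * e n + norm (z n - l)"
        using u by (simp add: X.norm_scale)
      then show ?thesis using n u by auto
    qed
    moreover have "\<exists>m>0. \<forall>j\<le>n. m \<le> \<eta> j"
      using \<eta> by (intro exI[of _ "Min (\<eta> ` {..n})"]) auto
    then obtain m where "m > 0" "\<And>j. j \<le> n \<Longrightarrow> m \<le> \<eta> j" by blast
    ultimately show "\<exists>\<eta>>0. \<forall>x. norm x \<le> 1 \<longrightarrow> pnorm P - \<eta> < norm (P x) \<longrightarrow>
        (\<exists>c. norm c = 1 \<and> norm (x - sX c l) < \<epsilon>)"
      by (intro exI[of _ m]) (fastforce simp: S_def N_def)
  qed
qed

section \<open>Iterated perturbation\<close>

text \<open>Around each Q (Suc n) there is a ball of radius r (Suc n) in which all polynomials peak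
  within 1 / (n + 1). The perturbations after step n add up to at most r n, so the limit stays in
  all these balls.\<close>

lemma strongly_attaining_near:
  assumes A: "uniformly_strongly_exposed sX A" "norming_for_hpoly k sX A" "A \<noteq> {}"
    and k: "k \<ge> 1" and P: "P \<in> HP" "pnorm P > 0" and e: "e > 0"
  obtains Q where "Q \<in> HP" "pnorm (\<lambda>x. P x - Q x) < e" "pnorm Q > 0" "strongly_attains_norm sX Q"
proof -
  \<comment> \<open>A state is a polynomial with the radius reserved for later perturbations. The
    start n = 0 carries no peaking condition; r < pnorm Q keeps the next polynomial nonzero.\<close>
  define I where "I n S \<longleftrightarrow> (case S of (Q, r) \<Rightarrow> Q \<in> HP \<and> 0 < r \<and> r < pnorm Q \<and>
      (\<forall>m. n = Suc m \<longrightarrow> (\<forall>R\<in>HP. pnorm (\<lambda>x. R x - Q x) \<le> r \<longrightarrow> peaks_within R (inverse (Suc m)))))"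
    for n and S :: "('a \<Rightarrow> 'b) \<times> real"
  define J where "J S S' \<longleftrightarrow> (case S of (Q, r) \<Rightarrow> case S' of (Q', r') \<Rightarrow> r' \<le> r / 2 \<and>
      (\<exists>f y. contraction_functional f \<and> norm y \<le> r / 2 \<and> Q' = (\<lambda>x. Q x + sY (f x ^ k) y)))"
    for S S' :: "('a \<Rightarrow> 'b) \<times> real"
  \<comment> \<open>Being below e and below the norm of P, it keeps the limit close to P and
    nonzero.\<close>
  define r0 where "r0 = min e (pnorm P) / 2"
  have r0: "r0 > 0" "r0 < e" "r0 < pnorm P" using e P(2) by (auto simp: r0_def)
  have step: "\<exists>S'. I (Suc n) S' \<and> J S S'" if "I n S" for n S
  proof -
    obtain Q r where S: "S = (Q, r)" and Q: "Q \<in> HP" and r: "0 < r" "r < pnorm Q"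
      using \<open>I n S\<close> by (cases S) (auto simp: I_def)
    obtain f y where f: "contraction_functional f" and y: "norm y \<le> r / 2"
      and peaks: "peaks_within (\<lambda>x. Q x + sY (f x ^ k) y) (inverse (Suc n))"
      using peaks_within_perturbation[OF A k Q, of "inverse (Suc n)" "r / 2"] r by auto
    define Q' where "Q' = (\<lambda>x. Q x + sY (f x ^ k) y)"
    have Q': "Q' \<in> HP"
      unfolding Q'_def by (intro hpoly_plus Q hpoly_functional_power f)
    obtain r' where r': "r' > 0" "\<And>R. R \<in> HP \<Longrightarrow> pnorm (\<lambda>x. R x - Q' x) \<le> r' \<Longrightarrow>
        peaks_within R (inverse (Suc n))"
      using peaks_within_open[OF Q', of "inverse (Suc n)"] peaks unfolding Q'_def by blast
    have "pnorm (\<lambda>x. Q x - Q' x) \<le> r / 2"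
      using order_trans[OF norm_functional_power_le[OF f] y]
      by (intro pnorm_leI) (simp add: Q'_def)
    then have "r / 2 < pnorm Q'"
      using pnorm_le_add_diff[OF Q Q'] r by simp
    then have "I (Suc n) (Q', min r' (r / 2))"
      using Q' r' r by (auto simp: I_def)
    moreover have "J S (Q', min r' (r / 2))"
      using f y by (auto simp: J_def S Q'_def)
    ultimately show ?thesis by blast
  qed
  have "I 0 (P, r0)" using P r0 by (simp add: I_def)
  then have "\<exists>g. (\<forall>n. (I n (g n) \<and> (n = 0 \<longrightarrow> g n = (P, r0))) \<and> J (g n) (g (Suc n)))"
    using step by (intro dependent_nat_choice) auto
  then obtain g where g: "\<And>n. I n (g n)" "g 0 = (P, r0)" "\<And>n. J (g n) (g (Suc n))"
    by blast
  define Q r where "Q n = fst (g n)" and "r n = snd (g n)" for n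
  have gn: "g n = (Q n, r n)" for n by (simp add: Q_def r_def)
  have Q: "Q n \<in> HP" and r_pos: "0 < r n" for n
    using g(1)[of n] by (auto simp: I_def gn)
  have peaks: "peaks_within R (inverse (Suc n))"
    if "R \<in> HP" "pnorm (\<lambda>x. R x - Q (Suc n) x) \<le> r (Suc n)" for R n
    using g(1)[of "Suc n"] that by (auto simp: I_def gn)
  have r_half: "r (Suc n) \<le> r n / 2" for n
    using g(3)[of n] by (auto simp: J_def gn)
  have "\<exists>f y. contraction_functional f \<and> norm y \<le> r n / 2 \<and>
      Q (Suc n) = (\<lambda>x. Q n x + sY (f x ^ k) y)" for n
    using g(3)[of n] by (auto simp: J_def gn)
  then obtain f y where f: "\<And>n. contraction_functional (f n)" and y: "\<And>n. norm (y n) \<le> r n / 2"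
    and Q_Suc: "\<And>n. Q (Suc n) = (\<lambda>x. Q n x + sY (f n x ^ k) (y n))"
    by metis
  have Q_eq: "Q n x = P x + (\<Sum>j<n. sY (f j x ^ k) (y j))" for n x
  proof (induction n)
    case 0
    then show ?case using g(2) by (simp add: Q_def)
  qed (simp add: Q_Suc)
  have r_le: "r (j + n) \<le> r n * (1 / 2) ^ j" for n j
  proof (induction j)
    case (Suc j)
    then show ?case using r_half[of "j + n"] by simp
  qed simp
  have y_le: "norm (y (j + n)) \<le> r n * (1 / 2) ^ Suc j" for n j
    using y[of "j + n"] r_le[of j n] by simp
  have geo: "(\<lambda>j. r n * (1 / 2) ^ Suc j) sums r n" for n
    using sums_mult[OF power_half_series, of "r n"] by (simp only: mult_1_right)
  have sum_y: "summable (\<lambda>n. norm (y n))"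
  proof (rule summable_comparison_test'[OF sums_summable[OF geo[of 0]]])
    show "norm (norm (y j)) \<le> r 0 * (1 / 2) ^ Suc j" for j
      using y_le[of j 0] by (simp only: real_norm_def abs_norm_cancel add_0_right)
  qed
  define R where "R x = P x + (\<Sum>n. sY (f n x ^ k) (y n))" for x
  have R: "R \<in> HP"
    unfolding R_def by (intro hpoly_plus P hpoly_suminf f sum_y)
  have R_Q: "pnorm (\<lambda>x. R x - Q n x) \<le> r n" for n
  proof (rule pnorm_leI)
    fix x :: 'a assume x: "norm x \<le> 1"
    have le: "norm (sY (f j x ^ k) (y j)) \<le> norm (y j)" for j
      by (rule norm_functional_power_le[OF f x])
    have "summable (\<lambda>j. sY (f j x ^ k) (y j))"
      by (rule summable_comparison_test'[OF sum_y le])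
    from suminf_split_initial_segment[OF this, of n]
    have "R x - Q n x = (\<Sum>j. sY (f (j + n) x ^ k) (y (j + n)))"
      by (simp add: R_def Q_eq)
    also have "norm \<dots> \<le> (\<Sum>j. r n * (1 / 2) ^ Suc j)"
      using le y_le by (intro norm_suminf_le sums_summable[OF geo]) (blast intro: order_trans)
    also have "\<dots> = r n"
      by (rule sums_unique[OF geo, symmetric])
    finally show "norm (R x - Q n x) \<le> r n" .
  qed
  have "strongly_attains_norm sX R"
  proof (rule strongly_attains_norm_if_peaks[OF R])
    fix e :: real assume "e > 0"
    then obtain n where "inverse (Suc n) < e"
      using reals_Archimedean by blast
    then show "peaks_within R e"
      using peaks[OF R R_Q] peaks_within_mono by (meson less_imp_le)
  qed
  moreover have PR: "pnorm (\<lambda>x. P x - R x) \<le> r0"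
    using R_Q[of 0] g(2) pnorm_minus_commute[of P R] by (simp add: Q_def r_def)
  moreover have "pnorm R > 0"
    using pnorm_le_add_diff[OF P(1) R] PR r0 by simp
  ultimately show thesis
    using R r0 by (intro that[of R]) auto
qed

text \<open>A polynomial of norm 0 is first replaced by f^k y' of norm e / 2. The limit is kept
  nonzero because differentiability will be proved only at nonzero polynomials.\<close>

lemma strongly_attaining_dense:
  assumes A: "uniformly_strongly_exposed sX A" "norming_for_hpoly k sX A" "A \<noteq> {}"
    and k: "k \<ge> 1" and Y: "(UNIV :: 'b set) \<noteq> {0}" and P: "P \<in> HP" and e: "e > 0"
  obtains Q where "Q \<in> HP" "pnorm (\<lambda>x. P x - Q x) < e" "pnorm Q > 0" "strongly_attains_norm sX Q"
proof (cases "pnorm P > 0")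
  case True
  then show ?thesis using strongly_attaining_near[OF A k P _ e] that by blast
next
  case False
  obtain a where a: "a \<in> A" using A(3) by blast
  then have norm_a: "norm a = 1"
    using A(1) by (auto simp: uniformly_strongly_exposed_def)
  obtain f where f: "contraction_functional f" "f a = 1"
    using uniformly_strongly_exposedE[OF A(1), of 1] a by (metis zero_less_one)
  obtain y :: 'b where "y \<noteq> 0" using Y by blast
  define y' where "y' = (e / 2) *\<^sub>R sgn y"
  have y': "norm y' = e / 2" using \<open>y \<noteq> 0\<close> e by (simp add: y'_def norm_sgn)
  define R where "R x = sY (f x ^ k) y'" for x
  have R: "R \<in> HP" unfolding R_def by (rule hpoly_functional_power[OF f(1)])
  have "norm (R a) = e / 2" by (simp add: R_def f y')
  then have "pnorm R > 0" using norm_le_pnorm[OF R, of a] norm_a e by simp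
  then obtain Q where Q: "Q \<in> HP" "pnorm (\<lambda>x. R x - Q x) < e / 2" "pnorm Q > 0"
      "strongly_attains_norm sX Q"
    using strongly_attaining_near[OF A k R, of "e / 2"] e by (metis half_gt_zero)
  have "pnorm R \<le> e / 2"
    unfolding R_def using norm_functional_power_le[OF f(1)] y' by (intro pnorm_leI) auto
  moreover have "pnorm (\<lambda>x. P x - R x) \<le> pnorm P + pnorm R"
    by (intro pnorm_leI order_trans[OF norm_triangle_ineq4 add_mono] norm_le_pnorm P R)
  ultimately have "pnorm (\<lambda>x. P x - R x) \<le> e / 2"
    using False by simp
  then have "pnorm (\<lambda>x. P x - Q x) < e"
    using pnorm_triangle[OF hpoly_minus[OF P R] hpoly_minus[OF R Q(1)]] Q(2) by simp
  then show ?thesis using that Q by blast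
qed

end

subsection \<open>Frechet differentiability of the norm\<close>

definition second_difference :: "('a::real_normed_vector \<Rightarrow> 'b::real_normed_vector) \<Rightarrow> ('a \<Rightarrow> 'b) \<Rightarrow> real \<Rightarrow> real" where
  "second_difference P Q \<delta> =
    pnorm (\<lambda>x. P x + \<delta> *\<^sub>R Q x) + pnorm (\<lambda>x. P x - \<delta> *\<^sub>R Q x) - 2 * pnorm P"

context banach_pair
begin

text \<open>Otherwise points with values tending to the norm would stay \<open>\<rho>\<close> away
  from the orbit of z, and no subsequence could converge to a point of it.\<close>

lemma strongly_attains_norm_atD:
  assumes P: "P \<in> HP" and z: "strongly_attains_norm_at sX P z" and \<rho>: "\<rho> > 0"
  obtains \<eta> where "\<eta> > 0" "\<And>x. norm x \<le> 1 \<Longrightarrow> pnorm P - \<eta> < norm (P x) \<Longrightarrow>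
    \<exists>c. norm c = 1 \<and> norm (x - sX c z) < \<rho>"
proof -
  have "\<exists>\<eta>>0. \<forall>x. norm x \<le> 1 \<longrightarrow> pnorm P - \<eta> < norm (P x) \<longrightarrow>
      (\<exists>c. norm c = 1 \<and> norm (x - sX c z) < \<rho>)"
  proof (rule ccontr)
    assume *: "\<not> ?thesis"
    have "\<exists>x. norm x \<le> 1 \<and> pnorm P - inverse (Suc n) < norm (P x) \<and>
        (\<forall>c. norm c = 1 \<longrightarrow> \<rho> \<le> norm (x - sX c z))" for n
    proof -
      have "inverse (real (Suc n)) > 0" by simp
      with * show ?thesis by (metis not_less)
    qed
    then obtain x where x: "\<And>n. norm (x n) \<le> 1" "\<And>n. pnorm P - inverse (Suc n) < norm (P (x n))"
      and far: "\<And>n c. norm c = 1 \<Longrightarrow> \<rho> \<le> norm (x n - sX c z)"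
      by metis
    have "(\<lambda>n. norm (P (x n))) \<longlonglongrightarrow> pnorm P"
    proof (rule tendsto_sandwich[OF _ _ _ tendsto_const])
      show "(\<lambda>n. pnorm P - inverse (Suc n)) \<longlonglongrightarrow> pnorm P"
        using tendsto_diff[OF tendsto_const LIMSEQ_inverse_real_of_nat] by simp
    qed (intro always_eventually allI less_imp_le[OF x(2)] norm_le_pnorm[OF P x(1)])+
    then obtain r c where c: "norm c = 1" and lim: "(x \<circ> r) \<longlonglongrightarrow> sX c z"
      using z x(1) unfolding strongly_attains_norm_at_def mem_cball_0 by blast
    from tendstoD[OF lim \<rho>] obtain n where "norm (x (r n) - sX c z) < \<rho>"
      by (auto simp: eventually_sequentially dist_norm)
    with far[OF c, of "r n"] show False by simp
  qed
  then show thesis using that by blast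
qed

lemma second_difference_bounds:
  assumes P: "P \<in> HP" and Q: "Q \<in> HP"
  shows "0 \<le> second_difference P Q \<delta>"
    and "second_difference P Q \<delta> \<le> 2 * \<bar>\<delta>\<bar> * pnorm Q"
proof -
  note \<delta>Q = hpoly_scaleR[OF Q, of \<delta>]
  have "pnorm (\<lambda>x. 2 *\<^sub>R P x) \<le> pnorm (\<lambda>x. P x + \<delta> *\<^sub>R Q x) + pnorm (\<lambda>x. P x - \<delta> *\<^sub>R Q x)"
    using pnorm_triangle[OF hpoly_plus[OF P \<delta>Q] hpoly_minus[OF P \<delta>Q]]
    by (simp add: scaleR_2)
  then show "0 \<le> second_difference P Q \<delta>"
    by (simp add: second_difference_def pnorm_scaleR[OF P])
  have "pnorm (\<lambda>x. P x - \<delta> *\<^sub>R Q x) \<le> pnorm P + \<bar>\<delta>\<bar> * pnorm Q"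
    using pnorm_triangle[OF P hpoly_scaleR[OF Q, of "- \<delta>"]] pnorm_scaleR[OF Q, of "- \<delta>"] by simp
  then show "second_difference P Q \<delta> \<le> 2 * \<bar>\<delta>\<bar> * pnorm Q"
    using pnorm_triangle[OF P \<delta>Q] pnorm_scaleR[OF Q, of \<delta>]
    by (simp add: second_difference_def)
qed

lemma second_difference_minus: "second_difference P Q (- \<delta>) = second_difference P Q \<delta>"
  by (simp add: second_difference_def)

text \<open>The difference quotient of a convex function is monotone.\<close>

lemma second_difference_mono:
  assumes P: "P \<in> HP" and Q: "Q \<in> HP" and s: "0 < s" "s \<le> \<delta>"
  shows "second_difference P Q s \<le> s / \<delta> * second_difference P Q \<delta>"
proof -
  define t where "t = s / \<delta>"
  have t: "0 \<le> t" "t \<le> 1" "t * \<delta> = s" using s by (auto simp: t_def)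
  \<comment> \<open>P + t r Q is a convex combination of P and P + r Q.\<close>
  have conv: "pnorm (\<lambda>x. P x + (t * r) *\<^sub>R Q x) \<le> (1 - t) * pnorm P + t * pnorm (\<lambda>x. P x + r *\<^sub>R Q x)"
    for r
  proof -
    have R: "(\<lambda>x. P x + r *\<^sub>R Q x) \<in> HP"
      by (intro hpoly_plus P hpoly_scaleR Q)
    have "(\<lambda>x. P x + (t * r) *\<^sub>R Q x) = (\<lambda>x. (1 - t) *\<^sub>R P x + t *\<^sub>R (P x + r *\<^sub>R Q x))"
      by (simp add: algebra_simps)
    then have "pnorm (\<lambda>x. P x + (t * r) *\<^sub>R Q x)
        \<le> pnorm (\<lambda>x. (1 - t) *\<^sub>R P x) + pnorm (\<lambda>x. t *\<^sub>R (P x + r *\<^sub>R Q x))"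
      using pnorm_triangle[OF hpoly_scaleR[OF P] hpoly_scaleR[OF R]] by simp
    then show ?thesis
      using t by (simp add: pnorm_scaleR P R)
  qed
  show ?thesis
    using conv[of \<delta>] conv[of "- \<delta>"] t
    by (simp add: second_difference_def algebra_simps flip: t_def)
qed

text \<open>By \<open>second_difference_mono\<close>, a bound at one \<open>\<delta>\<close>
  controls all smaller increments, so the limit becomes the existence of a single
  \<open>\<delta>\<close> for each e. Unit polynomials must exist, lest the supremum range over the
  empty set.\<close>

lemma norm_frechet_differentiable_iff:
  assumes P: "P \<in> HP" and unit: "{Q \<in> HP. pnorm Q = 1} \<noteq> {}"
  shows "norm_frechet_differentiable_at HP P \<longleftrightarrow>
    (\<forall>e>0. \<exists>\<delta>>0. \<forall>Q\<in>HP. pnorm Q = 1 \<longrightarrow> second_difference P Q \<delta> \<le> e * \<delta>)"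
proof -
  let ?U = "{Q \<in> HP. pnorm Q = 1}"
  define \<phi> where "\<phi> \<delta> = (SUP Q\<in>?U. second_difference P Q \<delta> / \<delta>)" for \<delta>
  have frechet: "norm_frechet_differentiable_at HP P \<longleftrightarrow> (\<phi> \<longlongrightarrow> 0) (at 0)"
    by (simp add: norm_frechet_differentiable_at_def \<phi>_def[abs_def] second_difference_def)
  show ?thesis
    unfolding frechet
  proof (intro iffI allI impI)
    fix e :: real assume lim: "(\<phi> \<longlongrightarrow> 0) (at 0)" and e: "e > 0"
    obtain d where d: "d > 0" "\<And>\<delta>. \<delta> \<noteq> 0 \<Longrightarrow> dist \<delta> 0 < d \<Longrightarrow> \<bar>\<phi> \<delta>\<bar> < e"
      using tendstoD[OF lim e] by (auto simp: eventually_at)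
    define \<delta> where "\<delta> = d / 2"
    have \<delta>: "\<delta> > 0" "\<bar>\<phi> \<delta>\<bar> < e" using d(1) d(2)[of \<delta>] by (auto simp: \<delta>_def)
    have "second_difference P Q \<delta> \<le> e * \<delta>" if Q: "Q \<in> HP" "pnorm Q = 1" for Q
    proof -
      have "second_difference P Q \<delta> / \<delta> \<le> \<phi> \<delta>"
        unfolding \<phi>_def
      proof (rule cSUP_upper)
        show "bdd_above ((\<lambda>Q. second_difference P Q \<delta> / \<delta>) ` ?U)"
        proof (rule bdd_aboveI2)
          fix Q assume "Q \<in> ?U"
          then show "second_difference P Q \<delta> / \<delta> \<le> 2"
            using \<delta>(1) second_difference_bounds(2)[OF P, of Q \<delta>] by (simp add: divide_le_eq)
        qed
      qed (use Q in auto)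
      then have "second_difference P Q \<delta> / \<delta> \<le> e" using \<delta>(2) by simp
      then show ?thesis using \<delta>(1) by (simp add: divide_le_eq)
    qed
    then show "\<exists>\<delta>>0. \<forall>Q\<in>HP. pnorm Q = 1 \<longrightarrow> second_difference P Q \<delta> \<le> e * \<delta>"
      using \<delta>(1) by blast
  next
    assume R: "\<forall>e>0. \<exists>\<delta>>0. \<forall>Q\<in>HP. pnorm Q = 1 \<longrightarrow> second_difference P Q \<delta> \<le> e * \<delta>"
    show "(\<phi> \<longlongrightarrow> 0) (at 0)"
    proof (rule tendstoI)
      fix e :: real assume e: "e > 0"
      then obtain \<delta> where \<delta>: "\<delta> > 0"
        "\<And>Q. Q \<in> HP \<Longrightarrow> pnorm Q = 1 \<Longrightarrow> second_difference P Q \<delta> \<le> e / 2 * \<delta>"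
        using R[rule_format, of "e / 2"] by auto
      have "\<bar>\<phi> t\<bar> \<le> e / 2" if t: "t \<noteq> 0" "\<bar>t\<bar> < \<delta>" for t
        unfolding \<phi>_def
      proof (rule cSup_abs_le)
        fix y assume "y \<in> (\<lambda>Q. second_difference P Q t / t) ` ?U"
        then obtain Q where Q: "Q \<in> HP" "pnorm Q = 1" and y: "y = second_difference P Q t / t"
          by blast
        have "second_difference P Q t = second_difference P Q \<bar>t\<bar>"
          by (simp add: abs_if second_difference_minus)
        also have "\<dots> \<le> \<bar>t\<bar> / \<delta> * second_difference P Q \<delta>"
          using t by (intro second_difference_mono P Q) auto
        also have "\<dots> \<le> \<bar>t\<bar> / \<delta> * (e / 2 * \<delta>)"
          using \<delta> Q by (intro mult_left_mono) auto
        also have "\<dots> = e / 2 * \<bar>t\<bar>" using \<delta>(1) by simp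
        finally show "\<bar>y\<bar> \<le> e / 2"
          using second_difference_bounds(1)[OF P Q(1), of t] t by (simp add: y divide_le_eq)
      qed (use unit in auto)
      then show "\<forall>\<^sub>F t in at 0. dist (\<phi> t) 0 < e"
        unfolding eventually_at using \<delta>(1) e by (intro exI[of _ \<delta>]) fastforce
    qed
  qed
qed

lemma hpoly_dist_eq: "P \<in> HP \<Longrightarrow> Q \<in> HP \<Longrightarrow> hpoly_dist k sX sY P Q = pnorm (\<lambda>x. P x - Q x)"
  by (simp add: hpoly_dist_def)

sublocale HP: Metric_space HP "hpoly_dist k sX sY"
  by (rule Metric_space_hpoly) unfold_locales

section \<open>The points of differentiability form a G-delta set\<close>

text \<open>For fixed \<open>\<delta>\<close>, moving P by less than r raises the second difference
  by at most 4 r, uniformly in Q; the gap between c and e absorbs this.\<close>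

lemma openin_almost_smooth:
  "openin (hpoly_topology k sX sY)
    {P \<in> HP. \<exists>\<delta>>0. \<exists>c<e. \<forall>Q\<in>HP. pnorm Q = 1 \<longrightarrow> second_difference P Q \<delta> \<le> c * \<delta>}"
  (is "openin _ ?G")
  unfolding hpoly_topology_def HP.openin_mtopology
proof (intro conjI allI impI)
  fix P assume "P \<in> ?G"
  then obtain \<delta> c where P: "P \<in> HP" and \<delta>: "\<delta> > 0" and c: "c < e"
    "\<And>Q. Q \<in> HP \<Longrightarrow> pnorm Q = 1 \<Longrightarrow> second_difference P Q \<delta> \<le> c * \<delta>"
    by blast
  \<comment> \<open>With this radius, 4 r is half of (e - c) \<open>\<delta>\<close>, which raises c
    to the midpoint (c + e) / 2.\<close>
  define r where "r = (e - c) * \<delta> / 8"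
  have r: "r > 0" using \<delta> c by (simp add: r_def)
  have "R \<in> ?G" if "R \<in> HP.mball P r" for R
  proof -
    have R: "R \<in> HP" and PR: "pnorm (\<lambda>x. P x - R x) < r"
      using that P by (auto simp: hpoly_dist_eq)
    have "second_difference R Q \<delta> \<le> (c + e) / 2 * \<delta>" if Q: "Q \<in> HP" "pnorm Q = 1" for Q
    proof -
      note \<delta>Q = hpoly_scaleR[OF Q(1), of \<delta>]
      have "pnorm (\<lambda>x. R x + \<delta> *\<^sub>R Q x) \<le> pnorm (\<lambda>x. P x + \<delta> *\<^sub>R Q x) + r"
        using pnorm_le_add_diff[OF hpoly_plus[OF R \<delta>Q] hpoly_plus[OF P \<delta>Q]] PR
          pnorm_minus_commute[of P R] by simp
      moreover have "pnorm (\<lambda>x. R x - \<delta> *\<^sub>R Q x) \<le> pnorm (\<lambda>x. P x - \<delta> *\<^sub>R Q x) + r"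
        using pnorm_le_add_diff[OF hpoly_minus[OF R \<delta>Q] hpoly_minus[OF P \<delta>Q]] PR
          pnorm_minus_commute[of P R] by simp
      moreover have "pnorm P \<le> pnorm R + r"
        using pnorm_le_add_diff[OF P R] PR by simp
      ultimately have "second_difference R Q \<delta> \<le> second_difference P Q \<delta> + 4 * r"
        by (simp add: second_difference_def)
      then show ?thesis
        using c(2)[OF Q] by (simp add: r_def field_simps)
    qed
    moreover have "(c + e) / 2 < e" using c(1) by simp
    ultimately show ?thesis
      using R \<delta> by blast
  qed
  then show "\<exists>r>0. HP.mball P r \<subseteq> ?G" using r by blast
qed blast

lemma gdelta_frechet:
  assumes unit: "{Q \<in> HP. pnorm Q = 1} \<noteq> {}"
  shows "gdelta_in (hpoly_topology k sX sY) {P \<in> HP. norm_frechet_differentiable_at HP P}"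
proof -
  define G where "G n = {P \<in> HP. \<exists>\<delta>>0. \<exists>c<inverse (real (Suc n)). \<forall>Q\<in>HP. pnorm Q = 1 \<longrightarrow>
      second_difference P Q \<delta> \<le> c * \<delta>}" for n
  have "{P \<in> HP. norm_frechet_differentiable_at HP P} = \<Inter> (range G)"
  proof (intro equalityI subsetI)
    fix P assume "P \<in> {P \<in> HP. norm_frechet_differentiable_at HP P}"
    then have P: "P \<in> HP" and F: "\<And>e. e > 0 \<Longrightarrow>
        \<exists>\<delta>>0. \<forall>Q\<in>HP. pnorm Q = 1 \<longrightarrow> second_difference P Q \<delta> \<le> e * \<delta>"
      using norm_frechet_differentiable_iff[OF _ unit] by auto
    have "P \<in> G n" for n
    proof -
      \<comment> \<open>Halving meets the strict inequality in G.\<close>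
      define c where "c = inverse (real (Suc n)) / 2"
      have "0 < c" "c < inverse (real (Suc n))" by (auto simp: c_def)
      then show ?thesis
        unfolding G_def using F[of c] P by blast
    qed
    then show "P \<in> \<Inter> (range G)" by blast
  next
    fix P assume P: "P \<in> \<Inter> (range G)"
    then have "P \<in> HP" by (auto simp: G_def)
    moreover have "\<exists>\<delta>>0. \<forall>Q\<in>HP. pnorm Q = 1 \<longrightarrow> second_difference P Q \<delta> \<le> e * \<delta>"
      if e: "e > 0" for e
    proof -
      obtain n where n: "inverse (real (Suc n)) < e"
        using reals_Archimedean[OF e] by blast
      obtain \<delta> c where \<delta>: "\<delta> > 0" and c: "c < inverse (real (Suc n))"
        "\<And>Q. Q \<in> HP \<Longrightarrow> pnorm Q = 1 \<Longrightarrow> second_difference P Q \<delta> \<le> c * \<delta>"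
        using P[THEN InterD, OF rangeI, of n] unfolding G_def by auto
      have "c * \<delta> \<le> e * \<delta>" using n c(1) \<delta> by (intro mult_right_mono) auto
      then have "second_difference P Q \<delta> \<le> e * \<delta>" if "Q \<in> HP" "pnorm Q = 1" for Q
        using c(2)[OF that] by linarith
      then show ?thesis using \<delta> by auto
    qed
    ultimately show "P \<in> {P \<in> HP. norm_frechet_differentiable_at HP P}"
      using norm_frechet_differentiable_iff[OF _ unit] by blast
  qed
  moreover have "gdelta_in (hpoly_topology k sX sY) (G n)" for n
    unfolding G_def by (rule open_imp_gdelta_in[OF openin_almost_smooth])
  ultimately show ?thesis
    by (auto intro!: gdelta_in_Inter)
qed

lemma hpoly_closure_ofI:
  assumes "S \<subseteq> HP"
    and "\<And>P e. P \<in> HP \<Longrightarrow> e > 0 \<Longrightarrow> \<exists>Q\<in>S. pnorm (\<lambda>x. P x - Q x) < e"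
  shows "hpoly_topology k sX sY closure_of S = HP"
  unfolding hpoly_topology_def HP.metric_closure_of
  using assms by (auto simp: hpoly_dist_eq subset_iff)

end

section \<open>Differentiability at strongly attaining polynomials\<close>

text \<open>The rotation that makes u positive depends on u in a Lipschitz way away from 0;
  multiplying by u v clears the denominators.\<close>

lemma norm_inverse_sgn_diff_le:
  fixes u v :: "'f::real_normed_field"
  assumes "u \<noteq> 0" "v \<noteq> 0"
  shows "norm (of_real (norm u) / u - of_real (norm v) / v) \<le> 2 * norm (u - v) / norm v"
proof -
  have "(of_real (norm u) / u - of_real (norm v) / v) * (u * v)
      = of_real (norm u) * (v - u) + of_real (norm u - norm v) * u"
    using assms by (simp add: field_simps)
  then have "norm (of_real (norm u) / u - of_real (norm v) / v) * (norm u * norm v)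
      = norm (of_real (norm u) * (v - u) + of_real (norm u - norm v) * u)"
    by (metis norm_mult)
  also have "\<dots> \<le> norm u * norm (u - v) + norm (u - v) * norm u"
  proof (rule norm_triangle_mono)
    show "norm (of_real (norm u) * (v - u)) \<le> norm u * norm (u - v)"
      by (simp add: norm_mult norm_minus_commute)
    have "\<bar>norm u - norm v\<bar> * norm u \<le> norm (u - v) * norm u"
      by (intro mult_right_mono norm_triangle_ineq3) simp
    then show "norm (of_real (norm u - norm v) * u) \<le> norm (u - v) * norm u"
      by (simp add: norm_mult del: of_real_diff)
  qed
  also have "\<dots> = (2 * norm (u - v) / norm v) * (norm u * norm v)"
    using assms by simp
  finally show ?thesis
    using assms by (simp add: mult_le_cancel_right_pos del: times_divide_eq_left)
qed

text \<open>
  Maximizers of \<open>P + \<delta> *\<^sub>R Q\<close> and \<open>P - \<delta> *\<^sub>R Q\<close> are, up to a rotation, close to the same point, where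
  the equicontinuous \<open>Q\<close> contribute nearly opposite amounts.
\<close>

lemma second_difference_strongly_attaining:
  fixes sX :: "'f::rc_field \<Rightarrow> 'a::banach \<Rightarrow> 'a"
  assumes X: "normed_space_over sX"
    and P: "P \<in> hpoly k sX ((*) :: 'f \<Rightarrow> 'f \<Rightarrow> 'f)" "pnorm P > 0"
    and attains: "strongly_attains_norm sX P" and e: "e > 0"
  obtains \<delta> where "\<delta> > 0"
    "\<And>Q. Q \<in> hpoly k sX (*) \<Longrightarrow> pnorm Q = 1 \<Longrightarrow> second_difference P Q \<delta> \<le> e * \<delta>"
proof -
  interpret banach_pair sX "(*) :: 'f \<Rightarrow> 'f \<Rightarrow> 'f" k
    using X normed_space_over_self by (simp add: banach_pair_def)
  define N where "N = pnorm P"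
  have N: "N > 0" using P by (simp add: N_def)
  obtain z where z: "strongly_attains_norm_at sX P z"
    using attains by (auto simp: strongly_attains_norm_def)
  obtain K where K: "K > 0" and Lipschitz: "\<And>Q x y. Q \<in> HP \<Longrightarrow> norm x \<le> 1 \<Longrightarrow> norm y \<le> 1 \<Longrightarrow>
      norm (Q x - Q y) \<le> K * pnorm Q * norm (x - y)"
    using hpoly_Lipschitz by blast
  \<comment> \<open>The two almost maximal points will be 2 \<open>\<rho>\<close> apart at most, so
    unit polynomials differ there by at most e / 32.\<close>
  define \<rho> where "\<rho> = e / (64 * K)"
  have \<rho>: "\<rho> > 0" "K * (2 * \<rho>) = e / 32" using e K by (auto simp: \<rho>_def)
  obtain \<eta> where \<eta>: "\<eta> > 0" and slice: "\<And>x. norm x \<le> 1 \<Longrightarrow> N - \<eta> < norm (P x) \<Longrightarrow>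
      \<exists>c. norm c = 1 \<and> norm (x - sX c z) < \<rho>"
    using strongly_attains_norm_atD[OF P(1) z \<rho>(1)] unfolding N_def by blast
  \<comment> \<open>The first bound puts almost maximal points into the slice of P and keeps their
    values at least N / 2 in norm; the second makes 2 \<open>\<delta>\<close> at most e N / 32, as
    the estimate of u - v requires.\<close>
  define \<delta> where "\<delta> = min (min \<eta> (N / 2) / (2 + e)) (e * N / 64)"
  have \<delta>: "\<delta> > 0" using \<eta> N e by (simp add: \<delta>_def)
  have "\<delta> \<le> min \<eta> (N / 2) / (2 + e)" by (simp add: \<delta>_def)
  then have "\<delta> * (2 + e) \<le> min \<eta> (N / 2)" using e by (simp add: le_divide_eq)
  moreover have "e * \<delta> > 0" using e \<delta> by simp
  ultimately have \<delta>_le: "2 * \<delta> + e * \<delta> / 4 \<le> \<eta>" "2 * \<delta> + e * \<delta> / 4 \<le> N / 2" "\<delta> \<le> e * N / 64"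
    by (auto simp: algebra_simps \<delta>_def)
  have almost_max: "\<exists>x. norm x \<le> 1 \<and> norm (x - z) < \<rho> \<and> N / 2 \<le> norm (P x + s *\<^sub>R Q x) \<and>
      pnorm (\<lambda>x. P x + s *\<^sub>R Q x) - e * \<delta> / 4 < norm (P x + s *\<^sub>R Q x)"
    if Q: "Q \<in> HP" "pnorm Q = 1" and s: "\<bar>s\<bar> = \<delta>" for Q s
  proof -
    define R where "R x = P x + s *\<^sub>R Q x" for x
    have R: "R \<in> HP" unfolding R_def by (intro hpoly_plus P hpoly_scaleR Q)
    have "pnorm (\<lambda>x. P x - R x) = \<delta>"
      using pnorm_scaleR[OF Q(1), of "- s"] Q(2) s by (simp add: R_def)
    then have NR: "N - \<delta> \<le> pnorm R"
      using pnorm_le_add_diff[OF P(1) R] by (simp add: N_def)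
    have "pnorm R - e * \<delta> / 4 < pnorm R" using e \<delta> by simp
    then obtain x where x: "norm x \<le> 1" "pnorm R - e * \<delta> / 4 < norm (R x)"
      using less_pnormE[OF R] by blast
    have "norm (R x) \<le> norm (P x) + \<delta> * norm (Q x)"
      using norm_triangle_ineq[of "P x" "s *\<^sub>R Q x"] s by (simp add: R_def)
    also have "\<dots> \<le> norm (P x) + \<delta> * 1"
      using norm_le_pnorm[OF Q(1) x(1)] Q(2) \<delta> by (intro add_mono mult_left_mono) auto
    finally have "N - \<eta> < norm (P x)"
      using x(2) NR \<delta>_le(1) by simp
    then obtain c where c: "norm c = 1" "norm (x - sX c z) < \<rho>"
      using slice[OF x(1)] by blast
    have "c \<noteq> 0" using c(1) by auto
    \<comment> \<open>Rotating x replaces closeness to the orbit of z by closeness to z itself, so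
      that the points found for P + \<open>\<delta>\<close> Q and P - \<open>\<delta>\<close> Q are
      close to each other.\<close>
    then have "sX (inverse c) x - z = sX (inverse c) (x - sX c z)"
      by (simp add: X.scale_right_diff_distrib)
    then have "norm (sX (inverse c) x - z) < \<rho>"
      using c by (simp add: X.norm_scale norm_inverse)
    moreover have "norm (R (sX (inverse c) x)) = norm (R x)"
      using c by (intro norm_hpoly_unimodular[OF R]) (simp add: norm_inverse)
    moreover have "norm (sX (inverse c) x) \<le> 1"
      using x c by (simp add: X.norm_scale norm_inverse)
    moreover have "N / 2 \<le> norm (R x)"
      using x(2) NR \<delta>_le(2) \<delta> by linarith
    ultimately show ?thesis
      using x(2) unfolding R_def by (intro exI[of _ "sX (inverse c) x"]) simp
  qed
  have "second_difference P Q \<delta> \<le> e * \<delta>" if Q: "Q \<in> HP" "pnorm Q = 1" for Q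
  proof -
    obtain x where x: "norm x \<le> 1" "norm (x - z) < \<rho>" "N / 2 \<le> norm (P x + \<delta> *\<^sub>R Q x)"
        "pnorm (\<lambda>x. P x + \<delta> *\<^sub>R Q x) - e * \<delta> / 4 < norm (P x + \<delta> *\<^sub>R Q x)"
      using almost_max[OF Q, of \<delta>] \<delta> by auto
    obtain y where y: "norm y \<le> 1" "norm (y - z) < \<rho>" "N / 2 \<le> norm (P y - \<delta> *\<^sub>R Q y)"
        "pnorm (\<lambda>x. P x - \<delta> *\<^sub>R Q x) - e * \<delta> / 4 < norm (P y - \<delta> *\<^sub>R Q y)"
      using almost_max[OF Q, of "- \<delta>"] \<delta> by auto
    define u v where "u = P x + \<delta> *\<^sub>R Q x" and "v = P y - \<delta> *\<^sub>R Q y"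
    have u: "N / 2 \<le> norm u" "u \<noteq> 0" and v: "N / 2 \<le> norm v" "v \<noteq> 0"
      using x(3) y(3) N by (auto simp: u_def v_def)
    define \<alpha> \<beta> where "\<alpha> = of_real (norm u) / u" and "\<beta> = of_real (norm v) / v"
    have \<alpha>: "norm \<alpha> = 1" and \<beta>: "norm \<beta> = 1"
      using u v by (auto simp: \<alpha>_def \<beta>_def norm_divide)
    have Px: "norm (P x) \<le> N" "norm (P y) \<le> N"
      using norm_le_pnorm[OF P(1)] x y by (auto simp: N_def)
    have Qx: "norm (Q x) \<le> 1" "norm (Q y) \<le> 1"
      using norm_le_pnorm[OF Q(1)] Q(2) x y by auto
    have xy: "norm (x - y) \<le> 2 * \<rho>"
      using norm_triangle_ineq4[of "x - z" "y - z"] x(2) y(2) by simp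
    then have "K * norm (x - y) \<le> K * (2 * \<rho>)"
      using K by (intro mult_left_mono) auto
    then have Kxy: "K * norm (x - y) \<le> e / 32" using \<rho>(2) by simp
    have Qxy: "norm (Q x - Q y) \<le> e / 32"
      using Lipschitz[OF Q(1) x(1) y(1)] Q(2) Kxy by simp
    have "norm (P x - P y) \<le> N * (K * norm (x - y))"
      using Lipschitz[OF P(1) x(1) y(1)] by (simp add: N_def ac_simps)
    also have "\<dots> \<le> N * (e / 32)"
      using N Kxy by (intro mult_left_mono) auto
    finally have Pxy: "norm (P x - P y) \<le> N * (e / 32)" .
    have "u - v = (P x - P y) + \<delta> *\<^sub>R (Q x + Q y)"
      by (simp add: u_def v_def scaleR_add_right)
    also have "norm \<dots> \<le> N * (e / 32) + \<delta> * 2"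
      using \<delta> Qx by (intro norm_triangle_mono Pxy)
        (auto intro!: mult_left_mono order_trans[OF norm_triangle_ineq])
    finally have uv: "norm (u - v) \<le> N * e / 16"
      using \<delta>_le(3) by (simp add: algebra_simps)
    have "norm (\<alpha> - \<beta>) \<le> 2 * norm (u - v) / norm v"
      unfolding \<alpha>_def \<beta>_def by (rule norm_inverse_sgn_diff_le[OF u(2) v(2)])
    also have "\<dots> \<le> 2 * (N * e / 16) / (N / 2)"
      using uv v N e by (intro frac_le) auto
    also have "\<dots> = e / 4" using N by simp
    finally have \<alpha>\<beta>: "norm (\<alpha> - \<beta>) \<le> e / 4" .
    have diff: "norm (\<alpha> * Q x - \<beta> * Q y) \<le> e / 4 * 1 + 1 * (e / 32)"
    proof -
      have "\<alpha> * Q x - \<beta> * Q y = (\<alpha> - \<beta>) * Q x + \<beta> * (Q x - Q y)"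
        by (simp add: algebra_simps)
      also have "norm \<dots> \<le> e / 4 * 1 + 1 * (e / 32)"
      proof (rule norm_triangle_mono)
        show "norm ((\<alpha> - \<beta>) * Q x) \<le> e / 4 * 1"
          unfolding norm_mult using \<alpha>\<beta> Qx(1) e by (intro mult_mono) auto
        show "norm (\<beta> * (Q x - Q y)) \<le> 1 * (e / 32)"
          using \<beta> Qxy by (simp add: norm_mult)
      qed
      finally show ?thesis .
    qed
    \<comment> \<open>Once both values are rotated to the positive axis, P contributes at most 2 N
      and Q only the small difference \<open>\<alpha> * Q x - \<beta> * Q y\<close>. This uses at
      most half of e \<open>\<delta>\<close>; the other half pays for x and y being only almost
      maximal.\<close>
    have "of_real (norm u + norm v) = \<alpha> * u + \<beta> * v"
      using u v by (simp add: \<alpha>_def \<beta>_def)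
    also have "\<dots> = (\<alpha> * P x + \<beta> * P y) + \<delta> *\<^sub>R (\<alpha> * Q x - \<beta> * Q y)"
      by (simp add: u_def v_def algebra_simps)
    finally have "norm u + norm v = norm ((\<alpha> * P x + \<beta> * P y) + \<delta> *\<^sub>R (\<alpha> * Q x - \<beta> * Q y))"
      by (metis abs_of_nonneg add_nonneg_nonneg norm_ge_zero norm_of_real)
    also have "\<dots> \<le> (N + N) + \<delta> * (e / 4 * 1 + 1 * (e / 32))"
      using \<alpha> \<beta> Px \<delta> diff
      by (intro norm_triangle_mono) (auto simp: norm_mult)
    also have "\<delta> * (e / 4 * 1 + 1 * (e / 32)) = 9 / 32 * (e * \<delta>)" by simp
    also have "\<dots> \<le> 1 / 2 * (e * \<delta>)"
      using e \<delta> by (intro mult_right_mono) auto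
    finally have "norm u + norm v \<le> 2 * N + e * \<delta> / 2" by simp
    then show ?thesis
      using x(4) y(4) by (simp add: second_difference_def u_def v_def N_def)
  qed
  then show thesis using \<delta> by (intro that)
qed

section \<open>The degenerate case and the conclusion\<close>

text \<open>All polynomials have the same norm \<open>Sup {}\<close>, and the zero polynomial shows
  it to be 0. The k-th power of a functional that norms x then forces x = 0.\<close>

lemma empty_norming_set:
  fixes sX :: "'f::rc_field \<Rightarrow> 'a::banach \<Rightarrow> 'a"
  assumes X: "normed_space_over sX" and norming: "norming_for_hpoly k sX {}"
  shows "Sup {} = (0 :: real)"
    and "P \<in> hpoly k sX ((*) :: 'f \<Rightarrow> 'f \<Rightarrow> 'f) \<Longrightarrow> pnorm P = 0"
    and "x = (0 :: 'a)"
proof -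
  interpret banach_pair sX "(*) :: 'f \<Rightarrow> 'f \<Rightarrow> 'f" k
    using X normed_space_over_self by (simp add: banach_pair_def)
  have Sup: "pnorm P = Sup {}" if "P \<in> HP" for P
    using norming that by (simp add: norming_for_hpoly_def)
  show 0: "Sup {} = (0 :: real)"
    using Sup[OF hpoly_zero] by simp
  show zero: "P \<in> HP \<Longrightarrow> pnorm P = 0" for P
    using Sup 0 by simp
  obtain g :: "'a \<Rightarrow> 'f" where g: "Vector_Spaces.linear sX (*) g"
    "\<And>x. norm (g x) \<le> norm x" "norm x \<le> norm (g x)"
    using X.norming_functional[of x] by blast
  have "(\<lambda>x. g x ^ k * 1) \<in> HP"
    using g by (intro hpoly_functional_power) (simp add: contraction_functional_def)
  then have "norm (g x ^ k) \<le> 0"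
    using norm_hpoly_le[of "\<lambda>x. g x ^ k" x] zero by simp
  then show "x = 0" using g(3) by (simp split: if_splits)
qed

theorem theorem2p1:
  fixes sX :: "'f::rc_field \<Rightarrow> 'a::banach \<Rightarrow> 'a"
    and sY :: "'f \<Rightarrow> 'b::banach \<Rightarrow> 'b"
    and k :: nat
  assumes "normed_space_over sX" and "normed_space_over sY"
    and "(UNIV :: 'b set) \<noteq> {0}"
    and "k \<ge> 1"
    and "\<exists>A. uniformly_strongly_exposed sX A \<and> norming_for_hpoly k sX A"
  shows "hpoly_topology k sX sY closure_of {P \<in> hpoly k sX sY. strongly_attains_norm sX P}
           = hpoly k sX sY \<and>
         gdelta_in (hpoly_topology k sX ((*) :: 'f \<Rightarrow> 'f \<Rightarrow> 'f))
           {P \<in> hpoly k sX (*). norm_frechet_differentiable_at (hpoly k sX (*)) P} \<and>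
         hpoly_topology k sX ((*) :: 'f \<Rightarrow> 'f \<Rightarrow> 'f) closure_of
           {P \<in> hpoly k sX (*). norm_frechet_differentiable_at (hpoly k sX (*)) P}
           = hpoly k sX (*)"
proof -
  note X = assms(1) and Y = assms(2) and k = assms(4)
  interpret XY: banach_pair sX sY k
    using X Y by (simp add: banach_pair_def)
  interpret XF: banach_pair sX "(*) :: 'f \<Rightarrow> 'f \<Rightarrow> 'f" k
    using X normed_space_over_self by (simp add: banach_pair_def)
  obtain A where A: "uniformly_strongly_exposed sX A" "norming_for_hpoly k sX A"
    using assms(5) by blast
  show ?thesis
  proof (cases "A = {}")
    case True
    \<comment> \<open>X is the zero space, so every sequence converges to every point and every
      polynomial strongly attains its norm.\<close>
    note empty = empty_norming_set[OF X A(2)[unfolded True]]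
    have "x = 0" for x :: 'a by (rule empty(3))
    then have lim: "X \<longlonglongrightarrow> x" for X :: "nat \<Rightarrow> 'a" and x :: 'a
      by (metis (full_types) ext tendsto_const)
    then have "strongly_attains_norm sX P" for P :: "'a \<Rightarrow> 'b"
      unfolding strongly_attains_norm_def strongly_attains_norm_at_def
      using strict_mono_id norm_one by blast
    \<comment> \<open>The supremum ranges over the empty set, and \<open>Sup {}\<close> is 0
      here.\<close>
    moreover have "norm_frechet_differentiable_at XF.HP P" for P
    proof -
      have no_unit: "{Q \<in> XF.HP. pnorm Q = 1} = {}"
        using empty(2) by auto
      show ?thesis
        unfolding norm_frechet_differentiable_at_def no_unit image_empty empty(1)
        by (rule tendsto_const)
    qed
    ultimately show ?thesis
      using closure_of_topspace[of "hpoly_topology k sX sY"]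
        closure_of_topspace[of "hpoly_topology k sX ((*) :: 'f \<Rightarrow> 'f \<Rightarrow> 'f)"]
        gdelta_in_topspace[of "hpoly_topology k sX ((*) :: 'f \<Rightarrow> 'f \<Rightarrow> 'f)"]
      by (simp add: topspace_hpoly_topology X Y normed_space_over_self)
  next
    case False
    have "(1 :: 'f) \<notin> {0}" by simp
    then have UNIV: "(UNIV :: 'f set) \<noteq> {0}" by (metis UNIV_I)
    have dense_F: "\<exists>Q\<in>{P \<in> XF.HP. norm_frechet_differentiable_at XF.HP P}. pnorm (\<lambda>x. P x - Q x) < e"
      if unit: "{Q \<in> XF.HP. pnorm Q = 1} \<noteq> {}" and P: "P \<in> XF.HP" and e: "e > 0" for P e
    proof -
      obtain Q where Q: "Q \<in> XF.HP" "pnorm (\<lambda>x. P x - Q x) < e" "pnorm Q > 0"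
          "strongly_attains_norm sX Q"
        using XF.strongly_attaining_dense[OF A False k UNIV P e] .
      have "norm_frechet_differentiable_at XF.HP Q"
        unfolding XF.norm_frechet_differentiable_iff[OF Q(1) unit]
      proof (intro allI impI)
        fix e :: real assume "e > 0"
        then obtain \<delta> where "\<delta> > 0"
            "\<And>R. R \<in> XF.HP \<Longrightarrow> pnorm R = 1 \<Longrightarrow> second_difference Q R \<delta> \<le> e * \<delta>"
          using second_difference_strongly_attaining[OF X Q(1,3,4)] by blast
        then show "\<exists>\<delta>>0. \<forall>R\<in>XF.HP. pnorm R = 1 \<longrightarrow> second_difference Q R \<delta> \<le> e * \<delta>"
          by blast
      qed
      then show ?thesis using Q by blast
    qed
    \<comment> \<open>Density near the zero polynomial provides a polynomial of positive norm, which
      is then normalized.\<close>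
    obtain Q :: "'a \<Rightarrow> 'f" where Q: "Q \<in> XF.HP" "pnorm Q > 0"
      using XF.strongly_attaining_dense[OF A False k UNIV XF.hpoly_zero, of 1] by auto
    then have "(\<lambda>x. inverse (pnorm Q) *\<^sub>R Q x) \<in> {Q \<in> XF.HP. pnorm Q = 1}"
      using XF.pnorm_scaleR[OF Q(1)] XF.hpoly_scaleR[OF Q(1)] by simp
    then have unit: "{Q \<in> XF.HP. pnorm Q = 1} \<noteq> {}" by blast
    have "\<exists>Q\<in>{P \<in> XY.HP. strongly_attains_norm sX P}. pnorm (\<lambda>x. P x - Q x) < e"
      if P: "P \<in> XY.HP" and e: "e > 0" for P e
      using XY.strongly_attaining_dense[OF A False k assms(3) P e] by blast
    then show ?thesis
      using XY.hpoly_closure_ofI XF.hpoly_closure_ofI XF.gdelta_frechet[OF unit] dense_F[OF unit]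
      by simp
  qed
qed

end
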